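(* Let $g=\sum_{n\ge 0}x^{n^{2}}\in\mathbb{Z}/2[[x]]$, write $\frac{1}{g}=\sum_{i\ge 0}b_{i}x^{i}$ with $b_{i}\in\mathbb{Z}/2$, and let $B=\{n\ge 0: b_{n}=1\}$. Then the number of $n\in B$ with $n\le y$ and $n\equiv 3\pmod 8$ is $O\!\left(y\log\log(y)/\log(y)\right)$ as $y\to\infty$.
   Context: $\mathbb{Z}/2[[x]]$ is the ring of formal power series over the field with two elements; $g$ has constant term $1$ and so is invertible there. *)

theory Defs
  imports
    Complex_Main
    "HOL-Library.Z2"
    "HOL-Library.Landau_Symbols"
    "HOL-Computational_Algebra.Formal_Power_Series"
    "HOL-Number_Theory.Cong"
begin

text \<open>
  The type \<open>bit\<close> is the field with two elements, so \<open>bit fps\<close> is the ring of formal power series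
  over it. The squares of distinct natural numbers are distinct, so the coefficients of the
  series are given by the indicator function of the squares; \<open>sq_series_sums\<close> identifies it with
  the sum of \<open>fps_X ^ (n\<^sup>2)\<close> over all n in the X-adic topology.
\<close>

definition sq_series :: "bit fps" where
  "sq_series = Abs_fps (\<lambda>k. if \<exists>n. k = n\<^sup>2 then 1 else 0)"

definition B :: "nat set" where
  "B = {n. fps_nth (1 / sq_series) n = 1}"

lemma sq_series_sums: "(\<lambda>n. fps_X ^ (n\<^sup>2)) sums sq_series"
  unfolding sums_def tendsto_fps_iff
proof
  fix k :: nat
  have coeff: "fps_nth (\<Sum>n<N. fps_X ^ (n\<^sup>2)) k = fps_nth sq_series k" if "k < N" for N
  proof (cases "\<exists>m. k = m\<^sup>2")
    case True
    then obtain m where m: "k = m\<^sup>2" by blast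
    have "m \<le> k" unfolding m by (simp add: power2_eq_square)
    have "(\<Sum>n<N. fps_nth (fps_X ^ (n\<^sup>2) :: bit fps) k) = (\<Sum>n<N. if n = m then 1 else 0)"
      by (intro sum.cong refl) (auto simp: m fps_X_power_nth power2_eq_iff)
    also have "\<dots> = 1" using \<open>m \<le> k\<close> that by simp
    finally show ?thesis using True by (simp add: fps_sum_nth sq_series_def)
  next
    case False
    then show ?thesis by (auto simp: fps_sum_nth sq_series_def fps_X_power_nth)
  qed
  show "\<forall>\<^sub>F N in sequentially. fps_nth (\<Sum>n<N. fps_X ^ (n\<^sup>2)) k = fps_nth sq_series k"
    using eventually_gt_at_top[of k] by eventually_elim (rule coeff)
qed

lemma sq_series_mult_inverse: "sq_series * (1 / sq_series) = 1"
proof -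
  have "fps_nth sq_series 0 \<noteq> 0" by (auto simp: sq_series_def)
  then show ?thesis by (simp add: fps_divide_unit inverse_mult_eq_1')
qed

end

theory Submission
  imports Defs "HOL-Computational_Algebra.Squarefree" "HOL-Real_Asymp.Real_Asymp"
begin

text \<open>
  Write F for the part of g with odd exponents, so that \<open>g = F + g\<^sup>4\<close>. Expanding \<open>1 / g = g\<^sup>7 / g\<^sup>8\<close>
  shows that the part of \<open>1 / g\<close> in degrees 3 mod 8 is \<open>F\<^sup>3 g\<^sup>8\<close>. Hence, for \<open>n = 3\<close> mod 8, the
  coefficient of \<open>1 / g\<close> is the parity of the number of solutions of \<open>a\<^sup>2 + 2 b\<^sup>2 + 8 c\<^sup>2 = n\<close> with a, b
  odd and a, b, c natural numbers. That number is half of \<open>T + T'\<close>, where T counts the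
  positive triples with \<open>x\<^sup>2 + y\<^sup>2 + z\<^sup>2 = n\<close> and \<open>T'\<close> those with \<open>y = z\<close>.

  An elementary form of genus theory shows that 4 divides T and \<open>T'\<close> as soon as three primes
  occur in n with odd exponents. View a triple as a pure Lipschitz quaternion v. For a divisor d of
  n coprime to \<open>n / d\<close> there is a quaternion q of norm d, unique up to left units, such that d
  divides \<open>q v\<close>, and sending v to the conjugate of v by q is an involution on the triples up to
  signs. It has no fixed point unless d or \<open>n / d\<close> is a square, it commutes with the exchange of y
  and z, and for coprime divisors these involutions compose multiplicatively. So two of them
  generate a group of order 4 acting freely.

  Otherwise n is a square times a prime or a product of two primes, and Chebyshev's bound, obtained
  from the central binomial coefficients, gives the estimate.
\<close>

section \<open>Integral quaternions\<close>

datatype quat = Quat (q0: int) (q1: int) (q2: int) (q3: int)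

instantiation quat :: ring_1
begin
definition "0 = Quat 0 0 0 0"
definition "1 = Quat 1 0 0 0"
definition "p + q = Quat (q0 p + q0 q) (q1 p + q1 q) (q2 p + q2 q) (q3 p + q3 q)"
definition "p - q = Quat (q0 p - q0 q) (q1 p - q1 q) (q2 p - q2 q) (q3 p - q3 q)"
definition "- q = Quat (- q0 q) (- q1 q) (- q2 q) (- q3 q)"
definition "p * q = Quat
  (q0 p * q0 q - q1 p * q1 q - q2 p * q2 q - q3 p * q3 q)
  (q0 p * q1 q + q1 p * q0 q + q2 p * q3 q - q3 p * q2 q)
  (q0 p * q2 q - q1 p * q3 q + q2 p * q0 q + q3 p * q1 q)
  (q0 p * q3 q + q1 p * q2 q - q2 p * q1 q + q3 p * q0 q)"
instance
  by standard
    (simp_all add: zero_quat_def one_quat_def plus_quat_def minus_quat_def uminus_quat_def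
      times_quat_def algebra_simps)
end

lemma quat_sel [simp]:
  "q0 0 = 0" "q1 0 = 0" "q2 0 = 0" "q3 0 = 0"
  "q0 1 = 1" "q1 1 = 0" "q2 1 = 0" "q3 1 = 0"
  "q0 (p + q) = q0 p + q0 q" "q1 (p + q) = q1 p + q1 q"
  "q2 (p + q) = q2 p + q2 q" "q3 (p + q) = q3 p + q3 q"
  "q0 (p - q) = q0 p - q0 q" "q1 (p - q) = q1 p - q1 q"
  "q2 (p - q) = q2 p - q2 q" "q3 (p - q) = q3 p - q3 q"
  "q0 (- q) = - q0 q" "q1 (- q) = - q1 q" "q2 (- q) = - q2 q" "q3 (- q) = - q3 q"
  "q0 (p * q) = q0 p * q0 q - q1 p * q1 q - q2 p * q2 q - q3 p * q3 q"
  "q1 (p * q) = q0 p * q1 q + q1 p * q0 q + q2 p * q3 q - q3 p * q2 q"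
  "q2 (p * q) = q0 p * q2 q - q1 p * q3 q + q2 p * q0 q + q3 p * q1 q"
  "q3 (p * q) = q0 p * q3 q + q1 p * q2 q - q2 p * q1 q + q3 p * q0 q"
  by (simp_all add: zero_quat_def one_quat_def plus_quat_def minus_quat_def uminus_quat_def
      times_quat_def)

lemma quat_sel_of_nat [simp]:
  "q0 (of_nat k) = int k" "q1 (of_nat k) = 0" "q2 (of_nat k) = 0" "q3 (of_nat k) = 0"
  by (induction k) simp_all

lemma quat_sel_of_int [simp]:
  "q0 (of_int k) = k" "q1 (of_int k) = 0" "q2 (of_int k) = 0" "q3 (of_int k) = 0"
  by (cases k; simp)+

lemma quat_eqI: "q0 p = q0 q \<Longrightarrow> q1 p = q1 q \<Longrightarrow> q2 p = q2 q \<Longrightarrow> q3 p = q3 q \<Longrightarrow> p = q"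
  by (rule quat.expand) simp

lemma quat_eq_iff: "p = q \<longleftrightarrow> q0 p = q0 q \<and> q1 p = q1 q \<and> q2 p = q2 q \<and> q3 p = q3 q"
  using quat_eqI by blast

section \<open>Conjugation, norm and divisibility by integers\<close>

definition qcnj :: "quat \<Rightarrow> quat" where
  "qcnj q = Quat (q0 q) (- q1 q) (- q2 q) (- q3 q)"

definition qnorm :: "quat \<Rightarrow> int" where
  "qnorm q = (q0 q)\<^sup>2 + (q1 q)\<^sup>2 + (q2 q)\<^sup>2 + (q3 q)\<^sup>2"

lemma qcnj_sel [simp]:
  "q0 (qcnj q) = q0 q" "q1 (qcnj q) = - q1 q" "q2 (qcnj q) = - q2 q" "q3 (qcnj q) = - q3 q"
  by (simp_all add: qcnj_def)

lemma qcnj_mult: "qcnj (p * q) = qcnj q * qcnj p"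
  by (rule quat_eqI) (simp_all add: algebra_simps)

lemma qcnj_of_int [simp]: "qcnj (of_int k) = of_int k"
  by (rule quat_eqI) simp_all

lemma mult_qcnj: "q * qcnj q = of_int (qnorm q)"
  by (rule quat_eqI) (simp_all add: qnorm_def power2_eq_square algebra_simps)

lemma qcnj_mult_self: "qcnj q * q = of_int (qnorm q)"
  by (rule quat_eqI) (simp_all add: qnorm_def power2_eq_square algebra_simps)

lemma qnorm_mult: "qnorm (p * q) = qnorm p * qnorm q"
  by (simp add: qnorm_def power2_eq_square algebra_simps)

lemma qnorm_of_int [simp]: "qnorm (of_int k) = k\<^sup>2"
  by (simp add: qnorm_def)

lemma qnorm_qcnj [simp]: "qnorm (qcnj q) = qnorm q"
  by (simp add: qnorm_def)

lemma qnorm_nonneg: "0 \<le> qnorm q"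
  by (simp add: qnorm_def)

lemma qnorm_eq_0_iff: "qnorm q = 0 \<longleftrightarrow> q = 0"
  by (auto simp: qnorm_def quat_eq_iff add_nonneg_eq_0_iff)

lemma of_int_mult_commute_quat: "of_int k * q = q * (of_int k :: quat)"
  by (rule quat_eqI) (simp_all)

lemma of_int_mult_cancel_quat: "k \<noteq> 0 \<Longrightarrow> of_int k * p = of_int k * (q :: quat) \<longleftrightarrow> p = q"
  by (simp add: quat_eq_iff)

instance quat :: Rings.dvd ..

text \<open>\<open>dvd\<close> puts the divisor on the left, but integers are central, so
  divisibility by an integer is two-sided and a matter of coordinates.\<close>

lemma of_int_dvd_quat_iff:
  "of_int k dvd (q :: quat) \<longleftrightarrow> k dvd q0 q \<and> k dvd q1 q \<and> k dvd q2 q \<and> k dvd q3 q"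
proof
  assume "k dvd q0 q \<and> k dvd q1 q \<and> k dvd q2 q \<and> k dvd q3 q"
  then have "q = of_int k * Quat (q0 q div k) (q1 q div k) (q2 q div k) (q3 q div k)"
    by (intro quat_eqI) simp_all
  then show "of_int k dvd q" by (rule dvdI)
qed (auto elim!: dvdE)

lemma of_int_dvd_mult_left: "of_int k dvd (q :: quat) \<Longrightarrow> of_int k dvd p * q"
  by (auto simp: of_int_dvd_quat_iff)

lemma dvd_quat_minus_iff: "of_int k dvd (- q :: quat) \<longleftrightarrow> of_int k dvd q"
  by (simp add: of_int_dvd_quat_iff)

lemma dvd_quat_diff: "of_int k dvd (p :: quat) \<Longrightarrow> of_int k dvd q \<Longrightarrow> of_int k dvd p - q"
  by (simp add: of_int_dvd_quat_iff)

lemma of_int_dvd_qcnj_iff: "of_int k dvd qcnj q \<longleftrightarrow> of_int k dvd q"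
  by (simp add: of_int_dvd_quat_iff)

lemma of_int_dvd_mult_right: "of_int k dvd (q :: quat) \<Longrightarrow> of_int k dvd q * p"
  by (auto simp: of_int_dvd_quat_iff)

lemma coprime_dvd_quat:
  assumes "coprime k l" "of_int k dvd of_int l * (q :: quat)"
  shows "of_int k dvd q"
  using assms by (auto simp: of_int_dvd_quat_iff coprime_dvd_mult_right_iff)

section \<open>Halving, division with remainder and elements of given norm\<close>

lemma even_qnorm_half:
  assumes "even (qnorm q)"
  obtains p where "qnorm p = 2" "of_int 2 dvd p * q"
proof -
  have e: "even (q0 q + q1 q + q2 q + q3 q)"
    using assms by (auto simp: qnorm_def)
  \<comment> \<open>The coordinate sum is even, so the coordinates split into two pairs with even
    sums. Left multiplication by 1 + i, 1 + j or 1 + k forms sums and differences within the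
    pairs.\<close>
  consider "even (q0 q + q1 q)" "even (q2 q + q3 q)" | "even (q0 q + q2 q)" "even (q1 q + q3 q)"
    | "even (q0 q + q3 q)" "even (q1 q + q2 q)"
    using e by (auto simp: even_add)
  then show thesis
  proof cases
    case 1
    then show ?thesis
      by (intro that[of "Quat 1 1 0 0"]) (simp_all add: qnorm_def of_int_dvd_quat_iff ac_simps del: of_int_numeral)
  next
    case 2
    then show ?thesis
      by (intro that[of "Quat 1 0 1 0"]) (simp_all add: qnorm_def of_int_dvd_quat_iff ac_simps del: of_int_numeral)
  next
    case 3
    then show ?thesis
      by (intro that[of "Quat 1 0 0 1"]) (simp_all add: qnorm_def of_int_dvd_quat_iff ac_simps del: of_int_numeral)
  qed
qed

text \<open>The residue of least absolute value modulo an odd \<open>m\<close> is at most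
  \<open>(m - 1) / 2\<close>, hence strictly below \<open>m / 2\<close>.\<close>

lemma int_odd_near_multiple:
  assumes "odd (m :: int)" "0 < m"
  obtains b where "4 * (x - m * b)\<^sup>2 < m\<^sup>2"
proof -
  define h where "h = m div 2"
  have m: "m = 2 * h + 1" using assms(1) by (simp add: h_def)
  define b where "b = (x + h) div m"
  have "(x + h) mod m = x + h - m * b"
    by (simp add: b_def minus_mult_div_eq_mod)
  then have "- h \<le> x - m * b" "x - m * b \<le> h"
    using pos_mod_bound[of m "x + h"] pos_mod_sign[of m "x + h"] assms m by linarith+
  moreover define r where "r = x - m * b"
  ultimately have "\<bar>2 * r\<bar> < m" using m by linarith
  then have "\<bar>2 * r\<bar>\<^sup>2 < m\<^sup>2" by (intro power_strict_mono) auto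
  then have "4 * (x - m * b)\<^sup>2 < m\<^sup>2" unfolding r_def power2_abs power_mult_distrib by simp
  then show thesis by (rule that)
qed

text \<open>The strict bounds on the four coordinates add up to a norm strictly below
  \<open>m\<^sup>2\<close>. For even \<open>m\<close> all remainders could equal
  \<open>m / 2\<close>, which is how the Lipschitz order fails to be Euclidean.\<close>

lemma quat_division_odd:
  assumes "odd (m :: int)" "0 < m"
  obtains b a where "x = of_int m * b + a" "qnorm a < m\<^sup>2"
proof -
  obtain b0 where b0: "4 * (q0 x - m * b0)\<^sup>2 < m\<^sup>2" using int_odd_near_multiple assms .
  obtain b1 where b1: "4 * (q1 x - m * b1)\<^sup>2 < m\<^sup>2" using int_odd_near_multiple assms .
  obtain b2 where b2: "4 * (q2 x - m * b2)\<^sup>2 < m\<^sup>2" using int_odd_near_multiple assms .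
  obtain b3 where b3: "4 * (q3 x - m * b3)\<^sup>2 < m\<^sup>2" using int_odd_near_multiple assms .
  let ?b = "Quat b0 b1 b2 b3"
  have "qnorm (x - of_int m * ?b) < m\<^sup>2"
    using b0 b1 b2 b3 by (simp add: qnorm_def)
  then show thesis by (intro that[of ?b "x - of_int m * ?b"]) simp_all
qed

text \<open>The product \<open>(p * v) * qcnj (q * v)\<close> is divisible by
  \<open>d\<^sup>2\<close> and equals \<open>d * e\<close> times \<open>p * qcnj q\<close>, since
  the norm of \<open>v\<close> is central. Cancelling \<open>d\<close> and then the coprime
  \<open>e\<close> leaves the claim.\<close>

lemma dvd_mult_qcnj:
  assumes v: "qnorm v = d * e" and d: "d \<noteq> 0" and cop: "coprime d e"
    and p: "of_int d dvd p * v" and q: "of_int d dvd q * v"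
  shows "of_int d dvd p * qcnj q"
proof -
  obtain w w' where w: "p * v = of_int d * w" "q * v = of_int d * w'"
    using p q unfolding dvd_def by blast
  have "(p * v) * qcnj (q * v) = of_int d * (of_int d * (w * qcnj w'))"
    unfolding w qcnj_mult qcnj_of_int by (metis mult.assoc of_int_mult_commute_quat)
  moreover have "(p * v) * qcnj (q * v) = of_int d * (of_int e * (p * qcnj q))"
  proof -
    have "(p * v) * qcnj (q * v) = p * (v * qcnj v) * qcnj q"
      by (simp add: qcnj_mult mult.assoc)
    also have "\<dots> = of_int (d * e) * (p * qcnj q)"
      by (metis mult_qcnj v of_int_mult_commute_quat mult.assoc)
    finally show ?thesis by (simp add: mult.assoc)
  qed
  ultimately have "of_int e * (p * qcnj q) = of_int d * (w * qcnj w')"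
    using d of_int_mult_cancel_quat[of d] by metis
  then show ?thesis using coprime_dvd_quat[OF cop] by (metis dvdI)
qed

text \<open>The element of least norm generates the left ideal of all q with d | q v, and the
  ideal contains both d and v, of norms \<open>d\<^sup>2\<close> and \<open>d e\<close>.\<close>
lemma exists_qnorm_eq_divisor:
  fixes d e :: int
  assumes v: "qnorm v = d * e" "q0 v = 0" and d: "odd d" "0 < d" and cop: "coprime d e"
  obtains q where "qnorm q = d" "of_int d dvd q * v"
proof -
  \<comment> \<open>A pure quaternion squares to minus its norm; this puts \<open>v\<close> itself
    in the ideal.\<close>
  have vv: "v * v = - of_int (d * e)"
  proof -
    have "qcnj v = - v" using v(2) by (intro quat_eqI) simp_all
    then show ?thesis using mult_qcnj[of v] v(1) by (metis minus_minus mult_minus_right)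
  qed
  define P where "P q \<longleftrightarrow> q \<noteq> 0 \<and> of_int d dvd q * v" for q
  have Pd: "P (of_int d)"
    using d by (auto simp: P_def quat_eq_iff of_int_dvd_quat_iff)
  define q where "q = arg_min (\<lambda>q. nat (qnorm q)) P"
  have Pq: "P q" unfolding q_def using Pd by (rule arg_min_natI)
  have min: "qnorm q \<le> qnorm p" if "P p" for p
    using arg_min_nat_le[of P p "\<lambda>q. nat (qnorm q)"] that qnorm_nonneg[of p]
    by (simp add: q_def)
  have q: "q \<noteq> 0" "of_int d dvd q * v" using Pq by (simp_all add: P_def)
  have pos: "0 < qnorm q" using q(1) qnorm_nonneg[of q] qnorm_eq_0_iff[of q] by linarith
  have dvd_pq: "of_int d dvd p * qcnj q" if "of_int d dvd p * v" for p
    using dvd_mult_qcnj[OF v(1) _ cop that q(2)] d by simp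
  \<comment> \<open>Taking \<open>p = q\<close> in \<open>dvd_pq\<close> makes the scalar
    \<open>qnorm q\<close> divisible by \<open>d\<close>.\<close>
  obtain m where m: "qnorm q = d * m"
    using dvd_pq[OF q(2)] by (auto simp: mult_qcnj of_int_dvd_quat_iff elim!: dvdE)
  have m0: "0 < m" using pos m d by (simp add: zero_less_mult_iff)
  \<comment> \<open>If \<open>m\<close> were even, \<open>p * q / 2\<close> with \<open>p\<close> of
    norm 2 would lie in the ideal, as \<open>d\<close> is odd, and have half the norm of
    \<open>q\<close>.\<close>
  have odd: "odd m"
  proof
    assume "even m"
    then obtain p where p: "qnorm p = 2" "of_int 2 dvd p * q"
      using even_qnorm_half[of q] m by auto
    then obtain q' where q': "p * q = of_int 2 * q'" by (auto elim!: dvdE)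
    have "of_int d dvd of_int 2 * (q' * v)"
      using of_int_dvd_mult_left[OF q(2), of p] q' by (metis mult.assoc)
    then have "of_int d dvd q' * v"
      using d(1) coprime_dvd_quat[of d 2] by simp
    moreover have n: "2 * qnorm q = 4 * qnorm q'"
      using arg_cong[OF q', of qnorm] p(1) by (simp only: qnorm_mult qnorm_of_int) simp
    ultimately have "P q'" using pos by (auto simp: P_def qnorm_def)
    then show False using min[of q'] n pos by linarith
  qed
  \<comment> \<open>Right division by \<open>q\<close> amounts to dividing
    \<open>p * qcnj q / d\<close> by \<open>m\<close>. Oddness of \<open>m\<close> gives the
    remainder \<open>p - b * q\<close> a smaller norm than \<open>q\<close>, so minimality forces it
    to vanish.\<close>
  have gen: "\<exists>b. p = b * q" if p: "of_int d dvd p * v" for p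
  proof -
    obtain u where u: "p * qcnj q = of_int d * u" using dvd_pq[OF p] by (auto elim!: dvdE)
    obtain b a where ba: "u = of_int m * b + a" "qnorm a < m\<^sup>2"
      using quat_division_odd[OF odd m0] .
    have "of_int d * (of_int m * p) = p * (qcnj q * q)"
      by (metis m qcnj_mult_self of_int_mult of_int_mult_commute_quat mult.assoc)
    also have "\<dots> = of_int d * (of_int m * (b * q) + a * q)"
      using u ba(1) by (metis mult.assoc distrib_right)
    finally have "of_int m * p = of_int m * (b * q) + a * q"
      using d of_int_mult_cancel_quat[of d] by (metis less_irrefl)
    then have r: "of_int m * (p - b * q) = a * q" by (simp add: algebra_simps)
    from arg_cong[OF this, of qnorm] have nr: "m\<^sup>2 * qnorm (p - b * q) = qnorm a * qnorm q"
      by (simp add: qnorm_mult)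
    also have "\<dots> < m\<^sup>2 * qnorm q" using ba(2) pos by simp
    finally have "qnorm (p - b * q) < qnorm q" using m0 by simp
    moreover have "of_int d dvd (p - b * q) * v"
      using p of_int_dvd_mult_left[OF q(2), of b] dvd_quat_diff
      by (simp add: left_diff_distrib mult.assoc)
    ultimately have "p - b * q = 0" using min[of "p - b * q"] by (auto simp: P_def)
    then show ?thesis by auto
  qed
  obtain b where b: "of_int d = b * q" using gen[of "of_int d"] Pd by (auto simp: P_def)
  obtain c where c: "v = c * q"
    using gen[of v] vv by (auto simp: of_int_dvd_quat_iff)
  \<comment> \<open>With \<open>d\<close> and \<open>v\<close> as left multiples of
    \<open>q\<close>, comparing norms shows that \<open>m\<close> divides both \<open>d\<close> and
    \<open>e\<close>.\<close>
  have "d\<^sup>2 = qnorm b * (d * m)" using arg_cong[OF b, of qnorm] m by (simp add: qnorm_mult)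
  then have "d = qnorm b * m" using d by (simp add: power2_eq_square ac_simps)
  then have "m dvd d" by (metis dvd_triv_right)
  moreover have "d * e = qnorm c * (d * m)"
    using arg_cong[OF c, of qnorm] m v(1) by (simp add: qnorm_mult)
  then have "e = qnorm c * m" using d by (simp add: ac_simps)
  then have "m dvd e" by (metis dvd_triv_right)
  ultimately have "m dvd 1" using cop coprime_common_divisor by blast
  then have "m = 1" using m0 by simp
  then show thesis using that m q(2) by simp
qed

section \<open>The ideal of a divisor acting on pure quaternions\<close>

definition qabs :: "quat \<Rightarrow> quat" where
  "qabs q = Quat \<bar>q0 q\<bar> \<bar>q1 q\<bar> \<bar>q2 q\<bar> \<bar>q3 q\<bar>"

lemma qabs_sel [simp]:
  "q0 (qabs q) = \<bar>q0 q\<bar>" "q1 (qabs q) = \<bar>q1 q\<bar>" "q2 (qabs q) = \<bar>q2 q\<bar>" "q3 (qabs q) = \<bar>q3 q\<bar>"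
  by (simp_all add: qabs_def)

lemma qnorm_qabs [simp]: "qnorm (qabs q) = qnorm q"
  by (simp add: qnorm_def)

lemma qabs_minus [simp]: "qabs (- q) = qabs q"
  by (simp add: quat_eq_iff)

lemma qabs_qabs [simp]: "qabs (qabs q) = qabs q"
  by (simp add: quat_eq_iff)

lemma qcnj_pure: "q0 v = 0 \<Longrightarrow> qcnj v = - v"
  by (simp add: quat_eq_iff)

lemma mult_right_cancel_quat: "r \<noteq> 0 \<Longrightarrow> p * r = q * r \<longleftrightarrow> p = (q :: quat)"
proof
  assume r: "r \<noteq> 0" and "p * r = q * r"
  then have "p * (r * qcnj r) = q * (r * qcnj r)" by (simp flip: mult.assoc)
  then have "of_int (qnorm r) * p = of_int (qnorm r) * q"
    by (simp only: mult_qcnj of_int_mult_commute_quat)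
  then show "p = q" using r by (simp add: of_int_mult_cancel_quat qnorm_eq_0_iff)
qed simp

lemma q0_conjugate [simp]: "q0 v = 0 \<Longrightarrow> q0 (q * v * qcnj q) = 0"
  by (simp add: algebra_simps)

lemma q0_of_int_mult: "q0 (of_int k * q) = k * q0 q"
  by simp

lemma qnorm_eq_1_cases:
  assumes "qnorm u = 1"
  obtains "u = 1" | "u = -1" | "u = Quat 0 1 0 0" | "u = Quat 0 (-1) 0 0" | "u = Quat 0 0 1 0"
    | "u = Quat 0 0 (-1) 0" | "u = Quat 0 0 0 1" | "u = Quat 0 0 0 (-1)"
proof -
  have *: "a = 1 \<and> b = 0 \<and> c = 0 \<and> e = 0 \<or> a = 0 \<and> b = 1 \<and> c = 0 \<and> e = 0 \<or>
    a = 0 \<and> b = 0 \<and> c = 1 \<and> e = 0 \<or> a = 0 \<and> b = 0 \<and> c = 0 \<and> e = 1"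
    if "a + b + c + e = 1" "0 \<le> a" "0 \<le> b" "0 \<le> c" "0 \<le> e" for a b c e :: int
    using that by linarith
  have "u = 1 \<or> u = -1 \<or> u = Quat 0 1 0 0 \<or> u = Quat 0 (-1) 0 0 \<or> u = Quat 0 0 1 0 \<or>
    u = Quat 0 0 (-1) 0 \<or> u = Quat 0 0 0 1 \<or> u = Quat 0 0 0 (-1)"
    using *[OF assms[unfolded qnorm_def] zero_le_power2 zero_le_power2 zero_le_power2 zero_le_power2]
    unfolding quat_eq_iff
    by (elim disjE) (simp_all add: power2_eq_1_iff)
  then show thesis using that by blast
qed

lemma qabs_conjugate_unit:
  assumes "qnorm u = 1" "q0 v = 0"
  shows "qabs (u * v * qcnj u) = qabs v"
  using assms(1) by (cases rule: qnorm_eq_1_cases) (simp_all add: quat_eq_iff assms(2))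

text \<open>Conjugation by i, j or k negates two of the three imaginary coordinates; an overall
  negation supplies the patterns with an odd number of sign changes.\<close>

lemma qabs_eq_imp_conjugate:
  assumes "qabs v = qabs w" "q0 v = 0" "q0 w = 0"
  obtains u where "qnorm u = 1" "v = u * w * qcnj u \<or> v = - (u * w * qcnj u)"
proof -
  have *: "q1 v = q1 w \<or> q1 v = - q1 w" "q2 v = q2 w \<or> q2 v = - q2 w"
    "q3 v = q3 w \<or> q3 v = - q3 w"
    using assms(1) by (auto simp: quat_eq_iff abs_eq_iff)
  let ?P = "\<lambda>u. v = u * w * qcnj u \<or> v = - (u * w * qcnj u)"
  have "?P 1 \<or> ?P (Quat 0 1 0 0) \<or> ?P (Quat 0 0 1 0) \<or> ?P (Quat 0 0 0 1)"
    using * assms(2,3) by (elim disjE) (simp_all add: quat_eq_iff)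
  moreover have "qnorm 1 = 1" "qnorm (Quat 0 1 0 0) = 1" "qnorm (Quat 0 0 1 0) = 1"
    "qnorm (Quat 0 0 0 1) = 1"
    by (simp_all add: qnorm_def)
  ultimately show thesis using that by blast
qed

text \<open>This says \<open>w = q v q^-1\<close> without division, for an element \<open>q\<close>
  of norm \<open>d\<close> in the ideal. It is a relation because \<open>q\<close> is determined
  only up to a left unit, and \<open>w\<close> up to conjugation by that unit.\<close>

definition qrel :: "int \<Rightarrow> quat \<Rightarrow> quat \<Rightarrow> bool" where
  "qrel d v w \<longleftrightarrow> (\<exists>q. qnorm q = d \<and> of_int d dvd q * v \<and> q * v = w * q)"

text \<open>With \<open>q * v = d w'\<close> the conjugate is \<open>w' * qcnj q\<close>, so
  divisibility by \<open>d\<close> is what makes it integral.\<close>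

lemma qrel_exists:
  assumes v: "qnorm v = d * e" "q0 v = 0" and d: "odd d" "0 < d" and cop: "coprime d e"
  obtains w where "qrel d v w" "q0 w = 0" "qnorm w = d * e"
proof -
  obtain q where q: "qnorm q = d" "of_int d dvd q * v"
    using exists_qnorm_eq_divisor[OF assms] .
  obtain w' where w': "q * v = of_int d * w'" using q(2) unfolding dvd_def by blast
  define w where "w = w' * qcnj q"
  have eq: "q * v = w * q"
    by (simp only: w_def w' mult.assoc qcnj_mult_self q(1) of_int_mult_commute_quat[of d w'])
  have "of_int d * w = q * v * qcnj q"
    by (simp add: w_def w' mult.assoc)
  then have "d * q0 w = q0 (q * v * qcnj q)"
    by (metis q0_of_int_mult)
  then have "q0 w = 0" using d q0_conjugate[OF v(2)] by (metis less_irrefl mult_eq_0_iff)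
  moreover have "qnorm w = d * e"
    using arg_cong[OF eq, of qnorm] d v(1) q(1) by (simp add: qnorm_mult)
  ultimately show thesis using that eq q unfolding qrel_def by blast
qed

text \<open>For two admissible \<open>p\<close> and \<open>q\<close>, \<open>q * qcnj p\<close> is
  \<open>d\<close> times some \<open>u\<close> by \<open>dvd_mult_qcnj\<close>; norms make
  \<open>u\<close> a unit, and multiplying by \<open>p\<close> gives
  \<open>q = u * p\<close>.\<close>

lemma qrel_unique:
  assumes v: "qnorm v = d * e" and d: "0 < d" and cop: "coprime d e"
    and "qrel d v w1" "qrel d v w2"
  obtains u where "qnorm u = 1" "w2 = u * w1 * qcnj u"
proof -
  obtain p q where p: "qnorm p = d" "of_int d dvd p * v" "p * v = w1 * p"
    and q: "qnorm q = d" "of_int d dvd q * v" "q * v = w2 * q"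
    using assms(4,5) unfolding qrel_def by blast
  have "of_int d dvd q * qcnj p" using dvd_mult_qcnj v d cop p q by auto
  then obtain u where u: "q * qcnj p = of_int d * u" unfolding dvd_def by blast
  have "d\<^sup>2 = d\<^sup>2 * qnorm u"
    using arg_cong[OF u, of qnorm] p(1) q(1) by (simp add: qnorm_mult power2_eq_square)
  then have u1: "qnorm u = 1" using d by simp
  have "of_int d * q = q * (qcnj p * p)"
    by (simp only: qcnj_mult_self p(1) of_int_mult_commute_quat[of d q])
  also have "\<dots> = of_int d * (u * p)" using u by (simp flip: mult.assoc)
  finally have "of_int d * q = of_int d * (u * p)" .
  then have qu: "q = u * p" using d by (simp add: of_int_mult_cancel_quat)
  have "w2 * q = u * w1 * p" using p(3) q(3) qu by (simp add: mult.assoc)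
  also have "\<dots> = u * w1 * (qcnj u * u) * p" by (simp add: qcnj_mult_self u1)
  also have "\<dots> = (u * w1 * qcnj u) * q" by (simp add: qu mult.assoc)
  finally have "w2 = u * w1 * qcnj u"
    using mult_right_cancel_quat[of q] q(1) d qnorm_eq_0_iff[of q] by force
  then show thesis using that u1 by blast
qed

lemma qrel_minus: "qrel d v w \<Longrightarrow> qrel d (- v) (- w)"
  unfolding qrel_def using dvd_quat_minus_iff by auto

lemma qrel_conjugate_left:
  assumes "qrel d v w" "qnorm u = 1"
  shows "qrel d (u * v * qcnj u) w"
proof -
  obtain q where q: "qnorm q = d" "of_int d dvd q * v" "q * v = w * q"
    using assms(1) unfolding qrel_def by blast
  have eq: "(q * qcnj u) * (u * v * qcnj u) = q * v * qcnj u"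
  proof -
    have "(q * qcnj u) * (u * v * qcnj u) = q * (qcnj u * u) * v * qcnj u"
      by (simp only: mult.assoc)
    then show ?thesis by (simp add: qcnj_mult_self assms(2))
  qed
  show ?thesis unfolding qrel_def
  proof (intro exI[of _ "q * qcnj u"] conjI)
    show "of_int d dvd q * qcnj u * (u * v * qcnj u)"
      using of_int_dvd_mult_right[OF q(2)] eq by simp
    show "q * qcnj u * (u * v * qcnj u) = w * (q * qcnj u)"
      using q(3) eq by (simp add: mult.assoc)
  qed (use q assms(2) in \<open>simp add: qnorm_mult\<close>)
qed

text \<open>Taking conjugates in \<open>q * v = w * q\<close>, where \<open>v\<close> and
  \<open>w\<close> are pure, shows that \<open>qcnj q\<close> carries \<open>w\<close> back to
  \<open>v\<close>.\<close>

lemma qrel_sym: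
  assumes "qrel d v w" "q0 v = 0" "q0 w = 0"
  shows "qrel d w v"
proof -
  obtain q where q: "qnorm q = d" "of_int d dvd q * v" "q * v = w * q"
    using assms(1) unfolding qrel_def by blast
  have "qcnj (q * v) = qcnj (w * q)" using q(3) by simp
  then have "qcnj q * w = v * qcnj q" "qcnj (q * v) = - (v * qcnj q)"
    using assms(2,3) by (simp_all add: qcnj_mult qcnj_pure)
  moreover have "of_int d dvd v * qcnj q"
    using q(2) dvd_quat_minus_iff[of d "v * qcnj q"] of_int_dvd_qcnj_iff[of d "q * v"] calculation
    by simp
  ultimately show ?thesis
    unfolding qrel_def using q(1) by (intro exI[of _ "qcnj q"]) simp
qed

lemma coprime_mult_dvd_quat:
  "coprime k l \<Longrightarrow> of_int k dvd (q :: quat) \<Longrightarrow> of_int l dvd q \<Longrightarrow> of_int (k * l) dvd q"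
  unfolding of_int_dvd_quat_iff by (auto intro: divides_mult)

text \<open>The composite is carried by \<open>q * p\<close>; coprimality merges the divisibilities
  by \<open>d\<close> and \<open>d'\<close>.\<close>

lemma qrel_trans:
  assumes "qrel d v w" "qrel d' w z" "coprime d d'"
  shows "qrel (d * d') v z"
proof -
  obtain p q where p: "qnorm p = d" "of_int d dvd p * v" "p * v = w * p"
    and q: "qnorm q = d'" "of_int d' dvd q * w" "q * w = z * q"
    using assms(1,2) unfolding qrel_def by blast
  have eq: "(q * p) * v = q * w * p" using p(3) by (simp add: mult.assoc)
  have "of_int d dvd (q * p) * v" using of_int_dvd_mult_left[OF p(2)] by (simp add: mult.assoc)
  moreover have "of_int d' dvd (q * p) * v" using of_int_dvd_mult_right[OF q(2)] eq by simp
  ultimately have "of_int (d * d') dvd (q * p) * v"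
    using assms(3) coprime_mult_dvd_quat by blast
  moreover have "(q * p) * v = z * (q * p)" using eq q(3) by (simp add: mult.assoc)
  ultimately show ?thesis unfolding qrel_def using p(1) q(1)
    by (intro exI[of _ "q * p"]) (simp add: qnorm_mult)
qed

text \<open>Lets the relation descend to pure quaternions up to signs: a unit conjugation of
  \<open>v\<close> leaves \<open>w\<close> alone, and a negation passes to \<open>w\<close>.\<close>

lemma qrel_transport:
  assumes "qrel d v w" "q0 v = 0" "q0 w = 0" "q0 v' = 0" "qabs v' = qabs v"
  obtains w' where "qrel d v' w'" "q0 w' = 0" "qabs w' = qabs w"
proof -
  obtain u where u: "qnorm u = 1" "v' = u * v * qcnj u \<or> v' = - (u * v * qcnj u)"
    by (rule qabs_eq_imp_conjugate[OF assms(5,4,2)])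
  from u(2) show thesis
  proof
    assume "v' = u * v * qcnj u"
    then show thesis using that qrel_conjugate_left[OF assms(1) u(1)] assms(3) by simp
  next
    assume "v' = - (u * v * qcnj u)"
    then show thesis
      using that[of "- w"] qrel_minus[OF qrel_conjugate_left[OF assms(1) u(1)]] assms(3) by simp
  qed
qed

text \<open>Conjugation by \<open>j - k\<close>, up to the factor 2.\<close>
lemma qrel_swap:
  assumes "qrel d v w" "q0 v = 0" "q0 w = 0"
  shows "qrel d (Quat 0 (q1 v) (q3 v) (q2 v)) (Quat 0 (q1 w) (q3 w) (q2 w))"
proof -
  obtain q where q: "qnorm q = d" "of_int d dvd q * v" "q * v = w * q"
    using assms(1) unfolding qrel_def by blast
  \<comment> \<open>This is \<open>q\<close> conjugated by \<open>j - k\<close>. The same rotation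
    sends \<open>v\<close> and \<open>w\<close> to minus their swaps, and those two signs
    cancel.\<close>
  let ?q = "Quat (q0 q) (- q1 q) (- q3 q) (- q2 q)"
  show ?thesis unfolding qrel_def
  proof (intro exI[of _ ?q] conjI)
    show "qnorm ?q = d" using q(1) by (simp add: qnorm_def)
    show "of_int d dvd ?q * Quat 0 (q1 v) (q3 v) (q2 v)"
    proof -
      have "?q * Quat 0 (q1 v) (q3 v) (q2 v) =
        Quat (- q0 (q * v)) (q1 (q * v)) (q3 (q * v)) (q2 (q * v))"
        using assms(2) by (simp add: quat_eq_iff)
      then show ?thesis using q(2) unfolding of_int_dvd_quat_iff
        by (simp only: quat.sel dvd_minus_iff simp_thms)
    qed
    show "?q * Quat 0 (q1 v) (q3 v) (q2 v) = Quat 0 (q1 w) (q3 w) (q2 w) * ?q"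
      using q(3) assms(2,3) by (simp add: quat_eq_iff algebra_simps)
  qed
qed

section \<open>Fixed points and free actions\<close>

lemma int_sum3_squares_odd:
  fixes x y z :: int
  assumes "[x\<^sup>2 + y\<^sup>2 + z\<^sup>2 = 3] (mod 8)"
  shows "odd x \<and> odd y \<and> odd z"
proof -
  have even: "w\<^sup>2 mod 8 = 0 \<or> w\<^sup>2 mod 8 = 4" if w: "even w" for w :: int
  proof -
    obtain k where "w = 2 * k" using w by blast
    then have "w\<^sup>2 = 4 * k\<^sup>2" by (simp add: power_mult_distrib)
    moreover have "4 * t mod 8 = 0 \<or> 4 * t mod 8 = 4" for t :: int by presburger
    ultimately show ?thesis by simp
  qed
  have odd: "w\<^sup>2 mod 8 = 1" if w: "odd w" for w :: int
  proof -
    obtain k where w: "w = 2 * k + 1" using w oddE by blast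
    have "even (k * (k + 1))" by simp
    then obtain t where t: "k * (k + 1) = 2 * t" by (rule evenE)
    have "w\<^sup>2 = 4 * (k * (k + 1)) + 1" unfolding w by (simp add: power2_eq_square algebra_simps)
    then have "w\<^sup>2 = 1 + t * 8" unfolding t by simp
    then show ?thesis by (simp only: mod_mult_self1) simp
  qed
  \<comment> \<open>Squares are 0, 1 or 4 modulo 8, and three of them add up to 3 only as 1 + 1 +
    1.\<close>
  have "(x\<^sup>2 mod 8 + y\<^sup>2 mod 8 + z\<^sup>2 mod 8) mod 8 = (x\<^sup>2 + y\<^sup>2 + z\<^sup>2) mod 8"
    by (subst mod_add_left_eq [symmetric]) (simp only: mod_add_eq)
  also have "\<dots> = 3" using assms unfolding Cong.cong_def by simp
  finally have "(x\<^sup>2 mod 8 + y\<^sup>2 mod 8 + z\<^sup>2 mod 8) mod 8 = 3" .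
  moreover have "P \<and> Q \<and> R"
    if "(a + b + c) mod 8 = 3" "a = 1 \<and> P \<or> (a = 0 \<or> a = 4) \<and> \<not> P"
      "b = 1 \<and> Q \<or> (b = 0 \<or> b = 4) \<and> \<not> Q" "c = 1 \<and> R \<or> (c = 0 \<or> c = 4) \<and> \<not> R"
    for a b c :: int and P Q R
    using that by (elim disjE conjE) simp_all
  ultimately show ?thesis using even odd by blast
qed

text \<open>At a fixed point the unit can be absorbed into \<open>q\<close>, which then commutes or
  anticommutes with \<open>v\<close>. In the first case \<open>q\<close> lies in the plane spanned
  by 1 and \<open>v\<close>, which forces \<open>d\<close> or \<open>e\<close> to be a square; in
  the second \<open>q\<close> is pure and orthogonal to \<open>v\<close>, which forces an even
  norm.\<close>

lemma qrel_no_fixed_point: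
  assumes n: "qnorm v = d * e" "q0 v = 0" "[d * e = 3] (mod 8)"
    and d: "0 < d" "0 < e" and cop: "coprime d e"
    and nonsq: "\<not> (\<exists>k. d = k\<^sup>2)" "\<not> (\<exists>k. e = k\<^sup>2)"
    and r: "qrel d v w" "q0 w = 0"
  shows "qabs w \<noteq> qabs v"
proof
  assume "qabs w = qabs v"
  then obtain u where u: "qnorm u = 1" "w = u * v * qcnj u \<or> w = - (u * v * qcnj u)"
    by (rule qabs_eq_imp_conjugate[OF _ r(2) n(2)])
  obtain p where p: "qnorm p = d" "of_int d dvd p * v" "p * v = w * p"
    using r(1) unfolding qrel_def by blast
  define q where "q = qcnj u * p"
  have q: "qnorm q = d" "of_int d dvd q * v"
    using p of_int_dvd_mult_left[OF p(2), of "qcnj u"] u(1)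
    by (simp_all add: q_def qnorm_mult mult.assoc)
  have uw: "qcnj u * (u * v * qcnj u) * p = v * q"
  proof -
    have "qcnj u * (u * v * qcnj u) * p = (qcnj u * u) * v * q"
      by (simp only: mult.assoc q_def)
    then show ?thesis by (simp add: qcnj_mult_self u(1))
  qed
  have "q * v = qcnj u * w * p" using p(3) by (simp add: q_def mult.assoc)
  then have "q * v = v * q \<or> q * v = - (v * q)"
    using u(2) uw by auto
  then show False
  proof
    assume "q * v = v * q"
    then have x: "q1 q * q2 v = q2 q * q1 v" "q2 q * q3 v = q3 q * q2 v" "q1 q * q3 v = q3 q * q1 v"
      using n(2) by (simp_all add: quat_eq_iff mult.commute)
    have "d dvd q0 (q * v)" using q(2) of_int_dvd_quat_iff by blast
    then obtain k where k: "q0 (q * v) = d * k" by blast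
    \<comment> \<open>Lagrange's identity; the cross product of the two imaginary parts
      vanishes.\<close>
    have "(q0 (q * v))\<^sup>2 = qnorm v * (qnorm q - (q0 q)\<^sup>2)"
    proof -
      have "qnorm v * (qnorm q - (q0 q)\<^sup>2) = (q1 q * q1 v + q2 q * q2 v + q3 q * q3 v)\<^sup>2
          + (q1 q * q2 v - q2 q * q1 v)\<^sup>2 + (q2 q * q3 v - q3 q * q2 v)\<^sup>2
          + (q1 q * q3 v - q3 q * q1 v)\<^sup>2"
        using n(2) by (simp add: qnorm_def power2_eq_square algebra_simps)
      also have "\<dots> = (q0 (q * v))\<^sup>2"
        using x n(2) by (simp add: power2_eq_square algebra_simps)
      finally show ?thesis ..
    qed
    then have "d * (e * (d - (q0 q)\<^sup>2)) = d * (d * k\<^sup>2)"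
      unfolding n(1) q(1) k by (simp only: power2_eq_square ac_simps)
    then have *: "e * (d - (q0 q)\<^sup>2) = d * k\<^sup>2" 
      using d(1) by (simp only: mult_cancel_left) simp
    then have "d dvd e * (d - (q0 q)\<^sup>2)" by simp
    then have "d dvd d - (q0 q)\<^sup>2" using cop coprime_dvd_mult_right_iff by blast
    then have "d dvd (q0 q)\<^sup>2" using dvd_diff_right_iff[of d d "(q0 q)\<^sup>2"] by simp
    then obtain s where s: "(q0 q)\<^sup>2 = d * s" by blast
    have "d * (e * (1 - s)) = d * k\<^sup>2" using * s by (simp add: algebra_simps)
    then have k2: "e * (1 - s) = k\<^sup>2" using d by simp
    \<comment> \<open>Non-negativity leaves \<open>s = 0\<close>, where
      \<open>e = k\<^sup>2\<close>, or \<open>s = 1\<close>, where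
      \<open>d = (q0 q)\<^sup>2\<close>.\<close>
    have "0 \<le> d * s" "0 \<le> e * (1 - s)" unfolding k2 s[symmetric] by simp_all
    then have "0 \<le> s" "0 \<le> 1 - s" using d by (simp_all add: zero_le_mult_iff)
    then have "s = 0 \<or> s = 1" by linarith
    then show False using s k2 nonsq by auto
  next
    assume *: "q * v = - (v * q)"
    have odd: "odd (q1 v) \<and> odd (q2 v) \<and> odd (q3 v)"
      using n by (intro int_sum3_squares_odd) (simp add: qnorm_def)
    have "q0 (q * v) = - q0 (v * q)" "q1 (q * v) = - q1 (v * q)"
      unfolding * by simp_all
    then have z: "q0 q * q1 v = 0" "q1 q * q1 v + q2 q * q2 v + q3 q * q3 v = 0"
      using n(2) by (simp_all add: algebra_simps)
    have "q0 q = 0" using z(1) odd by auto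
    \<comment> \<open>The coordinates of \<open>v\<close> are odd, so orthogonality makes the
      coordinate sum of \<open>q\<close> even, and with it the norm \<open>d\<close>.\<close>
    moreover have "even (q1 q * q1 v + q2 q * q2 v + q3 q * q3 v)" using z(2) by simp
    then have "even (q1 q + q2 q + q3 q)" using odd by simp
    ultimately have "even (qnorm q)" by (simp add: qnorm_def)
    then have "even (d * e)" using q(1) by simp
    moreover have "odd k" if "k mod 8 = 3 mod 8" for k :: int using that by presburger
    ultimately show False using n(3) unfolding Cong.cong_def by blast
  qed
qed

text \<open>The orbits of the Klein four-group generated by \<open>f\<close> and \<open>g\<close>
  partition \<open>S\<close>, and freeness gives each of them four elements.\<close>

lemma four_dvd_card_if_free_involutions:
  assumes fin: "finite S"
    and maps: "\<And>x. x \<in> S \<Longrightarrow> f x \<in> S" "\<And>x. x \<in> S \<Longrightarrow> g x \<in> S"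
    and inv: "\<And>x. x \<in> S \<Longrightarrow> f (f x) = x" "\<And>x. x \<in> S \<Longrightarrow> g (g x) = x"
    and comm: "\<And>x. x \<in> S \<Longrightarrow> f (g x) = g (f x)"
    and free: "\<And>x. x \<in> S \<Longrightarrow> f x \<noteq> x" "\<And>x. x \<in> S \<Longrightarrow> g x \<noteq> x" "\<And>x. x \<in> S \<Longrightarrow> f (g x) \<noteq> x"
  shows "4 dvd card S"
proof -
  define orb where "orb x = {x, f x, g x, f (g x)}" for x
  have orb_eq: "orb y = orb x" if x: "x \<in> S" and y: "y \<in> orb x" for x y
  proof -
    have "f (f x) = x" "g (g x) = x" "f (g x) = g (f x)" "f (f (g x)) = g x" "g (g (f x)) = f x"
      using x inv comm maps by auto
    then show ?thesis using y by (auto simp: orb_def)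
  qed
  have sub: "orb x \<subseteq> S" if "x \<in> S" for x
    using that maps by (auto simp: orb_def)
  have U: "\<Union> (orb ` S) = S" using sub by (auto simp: orb_def)
  have "4 * card (orb ` S) = card (\<Union> (orb ` S))"
  proof (rule card_partition)
    show "card c = 4" if c: "c \<in> orb ` S" for c
    proof -
      obtain x where x: "x \<in> S" "c = orb x" using c by blast
      have "f x \<noteq> g x" using free(3) comm inv x(1) by metis
      moreover have "f x \<noteq> f (g x)" "g x \<noteq> f (g x)"
        using free x(1) maps inv by metis+
      ultimately show ?thesis
        using x free(1)[OF x(1)] free(2)[OF x(1)] free(3)[OF x(1)]
        by (simp add: orb_def card_insert_if eq_commute)
    qed
    show "c1 \<inter> c2 = {}" if "c1 \<in> orb ` S" "c2 \<in> orb ` S" "c1 \<noteq> c2" for c1 c2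
      using that orb_eq by blast
  qed (use fin U in auto)
  then show ?thesis using U by (metis dvd_triv_left)
qed

section \<open>Commuting involutions on positive triples\<close>

definition pos_triples :: "int \<Rightarrow> quat set" where
  "pos_triples n = {v. q0 v = 0 \<and> 0 < q1 v \<and> 0 < q2 v \<and> 0 < q3 v \<and> qnorm v = n}"

lemma finite_pos_triples [simp]: "finite (pos_triples n)"
proof (rule finite_subset)
  show "pos_triples n \<subseteq> (\<lambda>(x, y, z). Quat 0 x y z) ` ({0..n} \<times> {0..n} \<times> {0..n})"
  proof
    fix v assume v: "v \<in> pos_triples n"
    have sq: "x \<le> x\<^sup>2" if "0 < x" for x :: int using that by (simp add: power2_eq_square)
    have "n = (q1 v)\<^sup>2 + (q2 v)\<^sup>2 + (q3 v)\<^sup>2" "q1 v \<le> (q1 v)\<^sup>2" "q2 v \<le> (q2 v)\<^sup>2" "q3 v \<le> (q3 v)\<^sup>2"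
      using v sq by (auto simp: pos_triples_def qnorm_def)
    then have "q1 v \<le> n \<and> q2 v \<le> n \<and> q3 v \<le> n"
      using zero_le_power2[of "q1 v"] zero_le_power2[of "q2 v"] zero_le_power2[of "q3 v"]
      by linarith
    then show "v \<in> (\<lambda>(x, y, z). Quat 0 x y z) ` ({0..n} \<times> {0..n} \<times> {0..n})"
      using v by (intro rev_image_eqI[of "(q1 v, q2 v, q3 v)"])
        (auto simp: pos_triples_def quat_eq_iff)
  qed
qed simp

lemma qabs_pos_triple: "v \<in> pos_triples n \<Longrightarrow> qabs v = v"
  by (simp add: pos_triples_def quat_eq_iff)

text \<open>All coordinates are odd, hence nonzero, so each class of pure quaternions of norm
  \<open>n\<close> up to signs has exactly one representative in
  \<open>pos_triples n\<close>.\<close>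

lemma qabs_in_pos_triples:
  assumes "q0 v = 0" "qnorm v = n" "[n = 3] (mod 8)"
  shows "qabs v \<in> pos_triples n"
proof -
  have "odd (q1 v) \<and> odd (q2 v) \<and> odd (q3 v)"
    using assms by (intro int_sum3_squares_odd) (simp add: qnorm_def)
  then have "q1 v \<noteq> 0" "q2 v \<noteq> 0" "q3 v \<noteq> 0" by auto
  then show ?thesis using assms(1,2) by (simp add: pos_triples_def)
qed

text \<open>By \<open>qrel_unique\<close> two candidates for \<open>w\<close> differ by a unit
  conjugation, which changes signs only; \<open>qabs\<close> erases these, so the choice made by
  \<open>SOME\<close> does not matter.\<close>

definition qinv :: "int \<Rightarrow> quat \<Rightarrow> quat" where
  "qinv d v = qabs (SOME w. qrel d v w \<and> q0 w = 0)"

lemma qinv_eq: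
  assumes "qnorm v = d * e" "0 < d" "coprime d e" "qrel d v w" "q0 w = 0"
  shows "qinv d v = qabs w"
proof -
  define w' where "w' = (SOME w. qrel d v w \<and> q0 w = 0)"
  have w': "qrel d v w'" "q0 w' = 0"
    using someI[of "\<lambda>w. qrel d v w \<and> q0 w = 0" w] assms(4,5) by (auto simp: w'_def)
  obtain u where "qnorm u = 1" "w' = u * w * qcnj u"
    using qrel_unique[OF assms(1-4) w'(1)] .
  then show ?thesis using qabs_conjugate_unit assms(5) by (simp add: qinv_def w'_def[symmetric])
qed

lemma qinv_obtain:
  assumes v: "v \<in> pos_triples (d * e)" and d: "odd d" "0 < d" and cop: "coprime d e"
  obtains w where "qrel d v w" "q0 w = 0" "qnorm w = d * e" "qinv d v = qabs w"
proof -
  have v': "qnorm v = d * e" "q0 v = 0" using v by (simp_all add: pos_triples_def)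
  obtain w where "qrel d v w" "q0 w = 0" "qnorm w = d * e"
    using qrel_exists[OF v' d cop] .
  then show thesis using that qinv_eq[OF v'(1) d(2) cop] by blast
qed

lemma qinv_in_pos_triples:
  assumes "v \<in> pos_triples (d * e)" "odd d" "0 < d" "coprime d e" "[d * e = 3] (mod 8)"
  shows "qinv d v \<in> pos_triples (d * e)"
  using qinv_obtain[OF assms(1-4)] qabs_in_pos_triples[OF _ _ assms(5)] by metis

text \<open>Used to iterate: a value of \<open>qinv\<close> has the form \<open>qabs w\<close>,
  while the relation is known for \<open>w\<close> itself.\<close>

lemma qrel_imp_qinv_qabs:
  assumes "qrel d w z" "q0 w = 0" "q0 z = 0" "qnorm w = d * e" "0 < d" "coprime d e"
  shows "qinv d (qabs w) = qabs z"
proof -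
  obtain z' where "qrel d (qabs w) z'" "q0 z' = 0" "qabs z' = qabs z"
    using qrel_transport[OF assms(1-3), of "qabs w"] assms(2) by auto
  then show ?thesis using qinv_eq[of "qabs w" d e z'] assms by simp
qed

lemma qinv_qinv:
  assumes "v \<in> pos_triples (d * e)" "odd d" "0 < d" "coprime d e"
  shows "qinv d (qinv d v) = v"
proof -
  obtain w where w: "qrel d v w" "q0 w = 0" "qnorm w = d * e" "qinv d v = qabs w"
    using qinv_obtain[OF assms] .
  have "qrel d w v" using qrel_sym w assms(1) by (simp add: pos_triples_def)
  then show ?thesis
    using qrel_imp_qinv_qabs[of d w v e] w assms qabs_pos_triple by (simp add: pos_triples_def)
qed

text \<open>Exchanging \<open>c\<close> and \<open>d\<close> leaves the right-hand side unchanged,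
  which yields commutation. It also reduces the fixed points of the composite to those for the
  divisor \<open>c * d\<close>.\<close>

lemma qinv_comp:
  assumes v: "v \<in> pos_triples (c * d * e)" and odd: "odd c" "odd d" and pos: "0 < c" "0 < d"
    and cop: "coprime c d" "coprime c e" "coprime d e"
  shows "qinv c (qinv d v) = qinv (c * d) v"
proof -
  have eq: "c * d * e = d * (c * e)" "c * d * e = c * (d * e)" by simp_all
  obtain w where w: "qrel d v w" "q0 w = 0" "qnorm w = d * (c * e)" "qinv d v = qabs w"
    using qinv_obtain[of v d "c * e"] v odd pos cop eq by (auto simp: coprime_commute)
  obtain z where z: "qrel c w z" "q0 z = 0"
    using qrel_exists[of w c "d * e"] w odd pos cop by (auto simp: mult.left_commute)
  have "qrel (d * c) v z" using qrel_trans[OF w(1) z(1)] cop by (simp add: coprime_commute)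
  then have "qinv (c * d) v = qabs z"
    using qinv_eq[of v "c * d" e z] v pos cop z(2) by (simp add: pos_triples_def mult.commute)
  moreover have "qinv c (qabs w) = qabs z"
    using qrel_imp_qinv_qabs[OF z(1) w(2) z(2), of "d * e"] w pos cop
    by (simp add: mult.left_commute)
  ultimately show ?thesis using w(4) by simp
qed

lemma qinv_neq:
  assumes v: "v \<in> pos_triples (d * e)" and d: "odd d" "0 < d" "0 < e" and cop: "coprime d e"
    and n: "[d * e = 3] (mod 8)" and nonsq: "\<not> (\<exists>k. d = k\<^sup>2)" "\<not> (\<exists>k. e = k\<^sup>2)"
  shows "qinv d v \<noteq> v"
proof -
  obtain w where w: "qrel d v w" "q0 w = 0" "qinv d v = qabs w"
    using qinv_obtain[OF v d(1,2) cop] .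
  have "qabs w \<noteq> qabs v"
    using v by (intro qrel_no_fixed_point[OF _ _ n d(2,3) cop nonsq w(1,2)])
      (simp_all add: pos_triples_def)
  then show ?thesis using w(3) qabs_pos_triple[OF v] by simp
qed

definition qswap :: "quat \<Rightarrow> quat" where
  "qswap v = Quat (q0 v) (q1 v) (q3 v) (q2 v)"

lemma qswap_qswap [simp]: "qswap (qswap v) = v"
  by (simp add: qswap_def)

lemma qswap_in_pos_triples: "qswap v \<in> pos_triples n \<longleftrightarrow> v \<in> pos_triples n"
  by (auto simp: qswap_def pos_triples_def qnorm_def)

lemma qinv_qswap:
  assumes "v \<in> pos_triples (d * e)" "odd d" "0 < d" "coprime d e"
  shows "qinv d (qswap v) = qswap (qinv d v)"
proof -
  obtain w where w: "qrel d v w" "q0 w = 0" "qnorm w = d * e" "qinv d v = qabs w"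
    using qinv_obtain[OF assms] .
  have "qrel d (qswap v) (qswap w)"
    using qrel_swap[OF w(1)] w(2) assms(1) by (simp add: qswap_def pos_triples_def)
  moreover have "qnorm (qswap v) = d * e" "q0 (qswap w) = 0"
    using assms(1) w(2) by (auto simp: qswap_def pos_triples_def qnorm_def ac_simps)
  ultimately have "qinv d (qswap v) = qabs (qswap w)" using qinv_eq assms by blast
  also have "\<dots> = qswap (qabs w)" by (simp add: qswap_def quat_eq_iff)
  finally show ?thesis using w(4) by simp
qed

text \<open>The complementary divisors of \<open>c\<close>, \<open>d\<close> and
  \<open>c * d\<close> are \<open>d * e\<close>, \<open>c * e\<close> and \<open>e\<close>; the six
  non-square conditions exclude fixed points of the three corresponding involutions.\<close>

lemma four_dvd_card_pos_triples:
  assumes n: "n = c * d * e" "[n = 3] (mod 8)" and pos: "0 < c" "0 < d" "0 < e"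
    and cop: "coprime c d" "coprime c e" "coprime d e"
    and nonsq: "\<not> (\<exists>k. c = k\<^sup>2)" "\<not> (\<exists>k. d = k\<^sup>2)" "\<not> (\<exists>k. e = k\<^sup>2)"
      "\<not> (\<exists>k. c * d = k\<^sup>2)" "\<not> (\<exists>k. c * e = k\<^sup>2)" "\<not> (\<exists>k. d * e = k\<^sup>2)"
  shows "4 dvd card (pos_triples n)" "4 dvd card {v \<in> pos_triples n. q2 v = q3 v}"
proof -
  have "odd n" using n(2) cong_dvd_modulus[of n 3 8 2] by (auto simp: Cong.cong_def)
  then have odd: "odd c" "odd d" using n(1) by auto
  have eq: "n = c * (d * e)" "n = d * (c * e)" "n = (c * d) * e" using n(1) by simp_all
  have cop': "coprime c (d * e)" "coprime d (c * e)" "coprime (c * d) e"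
    using cop by (simp_all add: coprime_commute)
  have in_c: "qinv c v \<in> pos_triples n" if "v \<in> pos_triples n" for v
    using qinv_in_pos_triples[of v c "d * e"] that odd pos cop' n(2) unfolding eq(1)[symmetric] by blast
  have in_d: "qinv d v \<in> pos_triples n" if "v \<in> pos_triples n" for v
    using qinv_in_pos_triples[of v d "c * e"] that odd pos cop' n(2) unfolding eq(2)[symmetric] by blast
  have inv_c: "qinv c (qinv c v) = v" if "v \<in> pos_triples n" for v
    using qinv_qinv[of v c "d * e"] that odd pos cop' unfolding eq(1)[symmetric] by blast
  have inv_d: "qinv d (qinv d v) = v" if "v \<in> pos_triples n" for v
    using qinv_qinv[of v d "c * e"] that odd pos cop' unfolding eq(2)[symmetric] by blast
  have comp: "qinv c (qinv d v) = qinv (c * d) v" if "v \<in> pos_triples n" for v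
    using qinv_comp[of v c d e] that odd pos cop n(1) by blast
  have comp': "qinv d (qinv c v) = qinv (c * d) v" if "v \<in> pos_triples n" for v
    using qinv_comp[of v d c e] that odd pos cop n(1) by (simp add: coprime_commute mult.commute)
  have free_c: "qinv c v \<noteq> v" if "v \<in> pos_triples n" for v
    using qinv_neq[of v c "d * e"] that odd pos cop' n(2) nonsq unfolding eq(1)[symmetric] by simp
  have free_d: "qinv d v \<noteq> v" if "v \<in> pos_triples n" for v
    using qinv_neq[of v d "c * e"] that odd pos cop' n(2) nonsq unfolding eq(2)[symmetric] by simp
  have free_cd: "qinv (c * d) v \<noteq> v" if "v \<in> pos_triples n" for v
    using qinv_neq[of v "c * d" e] that odd pos cop' n(2) nonsq unfolding eq(3)[symmetric] by simp
  show "4 dvd card (pos_triples n)"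
    by (rule four_dvd_card_if_free_involutions[of _ "qinv c" "qinv d"])
      (simp_all add: in_c in_d inv_c inv_d comp comp' free_c free_d free_cd)
  have swap_c: "qinv c (qswap v) = qswap (qinv c v)" if "v \<in> pos_triples n" for v
    using qinv_qswap[of v c "d * e"] that odd pos cop' unfolding eq(1)[symmetric] by blast
  have swap_d: "qinv d (qswap v) = qswap (qinv d v)" if "v \<in> pos_triples n" for v
    using qinv_qswap[of v d "c * e"] that odd pos cop' unfolding eq(2)[symmetric] by blast
  \<comment> \<open>The second set consists of the fixed points of \<open>qswap\<close>, and the
    involutions preserve it because they commute with \<open>qswap\<close>.\<close>
  have fix_iff: "q2 v = q3 v \<longleftrightarrow> qswap v = v" for v
    by (auto simp: qswap_def quat_eq_iff)
  show "4 dvd card {v \<in> pos_triples n. q2 v = q3 v}"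
    unfolding fix_iff
    by (rule four_dvd_card_if_free_involutions[of _ "qinv c" "qinv d"])
      (auto simp: in_c in_d inv_c inv_d comp comp' free_c free_d free_cd
        simp flip: swap_c swap_d)
qed

section \<open>The reciprocal series in degrees 3 modulo 8\<close>

lemma bit_add_self [simp]: "x + x = (0 :: bit)"
  by (cases x) simp_all

lemma two_bit_fps [simp]: "(2 :: bit fps) = 0"
  by (rule fps_ext) (simp add: fps_numeral_nth)

lemma bit_fps_square_add: "(f + g)\<^sup>2 = f\<^sup>2 + (g :: bit fps)\<^sup>2"
  by (simp add: power2_sum)

text \<open>Frobenius in characteristic 2: the products for \<open>i\<close> and
  \<open>n - i\<close> cancel in pairs, leaving the middle one, and every element of the field is
  its own square.\<close>

lemma bit_fps_nth_square:
  "fps_nth (f\<^sup>2) n = (if even n then fps_nth f (n div 2) else (0 :: bit))"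
proof -
  let ?h = "\<lambda>i. fps_nth f i * fps_nth f (n - i)"
  have "fps_nth (f\<^sup>2) n = (\<Sum>i=0..n. ?h i)"
    by (simp add: power2_eq_square fps_mult_nth)
  also have "{0..n} = ({i. i \<le> n \<and> 2 * i < n} \<union> {i. i \<le> n \<and> n < 2 * i}) \<union> {i. i \<le> n \<and> 2 * i = n}"
    by auto
  also have "(\<Sum>i\<in>\<dots>. ?h i) = (\<Sum>i | i \<le> n \<and> 2 * i < n. ?h i) + (\<Sum>i | i \<le> n \<and> n < 2 * i. ?h i)
      + (\<Sum>i | i \<le> n \<and> 2 * i = n. ?h i)"
    by (subst sum.union_disjoint; (subst sum.union_disjoint)?) auto
  also have "(\<Sum>i | i \<le> n \<and> n < 2 * i. ?h i) = (\<Sum>i | i \<le> n \<and> 2 * i < n. ?h i)"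
    by (rule sum.reindex_bij_witness[of _ "\<lambda>i. n - i" "\<lambda>i. n - i"]) (auto simp: mult.commute)
  also have "(\<Sum>i | i \<le> n \<and> 2 * i = n. ?h i) = (if even n then fps_nth f (n div 2) else 0)"
  proof (cases "even n")
    case True
    then have "{i. i \<le> n \<and> 2 * i = n} = {n div 2}" by auto
    moreover have "n - n div 2 = n div 2" using True by auto
    moreover have "x * x = x" for x :: bit by (cases x) simp_all
    ultimately show ?thesis using True by simp
  next
    case False
    then have "{i. i \<le> n \<and> 2 * i = n} = {}" by auto
    then show ?thesis using False by (simp only: sum.empty) simp
  qed
  finally show ?thesis by simp
qed

text \<open>The generating function of a weight, reduced modulo 2. Finiteness is included because
  \<open>card\<close> would be 0 on an infinite fibre.\<close>

definition counted_by :: "'a set \<Rightarrow> ('a \<Rightarrow> nat) \<Rightarrow> bit fps \<Rightarrow> bool" where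
  "counted_by X w f \<longleftrightarrow> (\<forall>n. finite {x \<in> X. w x = n} \<and>
     fps_nth f n = of_nat (card {x \<in> X. w x = n}))"

lemma counted_by_mult:
  assumes f: "counted_by X v f" and g: "counted_by Y w g"
  shows "counted_by (X \<times> Y) (\<lambda>(x, y). v x + w y) (f * g)"
  unfolding counted_by_def
proof (intro allI conjI)
  fix n
  let ?A = "\<lambda>i. {x \<in> X. v x = i} \<times> {y \<in> Y. w y = n - i}"
  have eq: "{p \<in> X \<times> Y. (case p of (x, y) \<Rightarrow> v x + w y) = n} = (\<Union>i\<in>{0..n}. ?A i)"
    by auto
  have fin: "finite (?A i)" for i
    using f g by (simp add: counted_by_def)
  show "finite {p \<in> X \<times> Y. (case p of (x, y) \<Rightarrow> v x + w y) = n}"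
    unfolding eq using fin by blast
  have "card (\<Union>i\<in>{0..n}. ?A i) = (\<Sum>i=0..n. card (?A i))"
    using fin by (intro card_UN_disjoint) auto
  then show "fps_nth (f * g) n = of_nat (card {p \<in> X \<times> Y. (case p of (x, y) \<Rightarrow> v x + w y) = n})"
    unfolding eq using f g by (simp add: fps_mult_nth counted_by_def card_cartesian_product)
qed

text \<open>Over this field squaring substitutes \<open>x\<^sup>2\<close>, so it doubles weights
  instead of counting pairs.\<close>

lemma counted_by_square:
  assumes "counted_by X w f"
  shows "counted_by X (\<lambda>x. 2 * w x) (f\<^sup>2)"
  unfolding counted_by_def
proof (intro allI conjI)
  fix n
  show "finite {x \<in> X. 2 * w x = n}"
    by (rule finite_subset[of _ "{x \<in> X. w x = n div 2}"]) (use assms in \<open>auto simp: counted_by_def\<close>)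
  show "fps_nth (f\<^sup>2) n = of_nat (card {x \<in> X. 2 * w x = n})"
  proof (cases "even n")
    case True
    then have "{x \<in> X. 2 * w x = n} = {x \<in> X. w x = n div 2}" by auto
    then show ?thesis using True assms by (simp add: bit_fps_nth_square counted_by_def)
  next
    case False
    then have "{x \<in> X. 2 * w x = n} = {}" by auto
    then show ?thesis using False by (simp only: bit_fps_nth_square) simp
  qed
qed

lemma counted_by_squares:
  "counted_by X (\<lambda>a. a\<^sup>2) (Abs_fps (\<lambda>k. if \<exists>a\<in>X. k = a\<^sup>2 then 1 else 0))"
  unfolding counted_by_def
proof (intro allI conjI)
  fix n :: nat
  have sub: "{a \<in> X. a\<^sup>2 = n} \<subseteq> {..n}" by (auto simp: power2_eq_square)
  then show "finite {a \<in> X. a\<^sup>2 = n}" by (rule finite_subset) simp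
  show "fps_nth (Abs_fps (\<lambda>k. if \<exists>a\<in>X. k = a\<^sup>2 then 1 else 0)) n =
      (of_nat (card {a \<in> X. a\<^sup>2 = n}) :: bit)"
  proof (cases "\<exists>a\<in>X. n = a\<^sup>2")
    case True
    then obtain a where "a \<in> X" "n = a\<^sup>2" by blast
    then have "{a \<in> X. a\<^sup>2 = n} = {a}" by auto
    then show ?thesis using True by simp
  next
    case False
    then have "{a \<in> X. a\<^sup>2 = n} = {}" by auto
    then show ?thesis using False by (simp only:) simp
  qed
qed

text \<open>This is F of the overview. The bounded quantifier matches the form in
  \<open>counted_by_squares\<close>.\<close>

definition odd_sq_series :: "bit fps" where
  "odd_sq_series = Abs_fps (\<lambda>k. if \<exists>a\<in>{a. odd a}. k = a\<^sup>2 then 1 else 0)"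

lemma counted_by_sq_series: "counted_by UNIV (\<lambda>a. a\<^sup>2) sq_series"
  using counted_by_squares[of UNIV] by (simp add: sq_series_def)

lemma counted_by_odd_sq_series: "counted_by {a. odd a} (\<lambda>a. a\<^sup>2) odd_sq_series"
  unfolding odd_sq_series_def by (rule counted_by_squares)

lemma power4_eq_square_square: "x ^ 4 = (x\<^sup>2)\<^sup>2" for x :: "'a :: monoid_mult"
  by (simp flip: power_mult)

text \<open>By Frobenius the fourth power substitutes \<open>x^4\<close>, turning the exponents
  \<open>a\<^sup>2\<close> into the even squares \<open>(2 a)\<^sup>2\<close>.\<close>

lemma sq_series_eq: "sq_series = odd_sq_series + sq_series ^ 4"
proof (rule fps_ext)
  fix n
  have 4: "fps_nth (sq_series ^ 4) n = (if \<exists>a. even a \<and> n = a\<^sup>2 then 1 else 0)"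
  proof (cases "4 dvd n")
    case True
    then obtain m where n: "n = 4 * m" by blast
    have "(\<exists>a. m = a\<^sup>2) \<longleftrightarrow> (\<exists>a. even a \<and> n = a\<^sup>2)"
    proof
      assume "\<exists>a. m = a\<^sup>2"
      then obtain a where "m = a\<^sup>2" by blast
      then have "even (2 * a) \<and> n = (2 * a)\<^sup>2" by (simp add: n power_mult_distrib)
      then show "\<exists>a. even a \<and> n = a\<^sup>2" by blast
    next
      assume "\<exists>a. even a \<and> n = a\<^sup>2"
      then obtain b where "n = (2 * b)\<^sup>2" by (auto elim: evenE)
      then have "m = b\<^sup>2" by (simp add: n power_mult_distrib)
      then show "\<exists>a. m = a\<^sup>2" by blast
    qed
    moreover have "fps_nth (sq_series ^ 4) n = fps_nth sq_series m"
      unfolding power4_eq_square_square bit_fps_nth_square n by simp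
    ultimately show ?thesis
      by (simp only: sq_series_def fps_nth_Abs_fps)
  next
    case False
    then have "\<not> (even n \<and> even (n div 2))" by auto
    moreover have "\<not> (\<exists>a. even a \<and> n = a\<^sup>2)"
    proof
      assume "\<exists>a. even a \<and> n = a\<^sup>2"
      then obtain b where "n = (2 * b)\<^sup>2" by (auto elim: evenE)
      then show "False" using False by (simp add: power_mult_distrib)
    qed
    ultimately show ?thesis unfolding power4_eq_square_square bit_fps_nth_square by simp
  qed
  have "\<not> ((\<exists>a. even a \<and> n = a\<^sup>2) \<and> (\<exists>a. odd a \<and> n = a\<^sup>2))" by auto
  then show "fps_nth sq_series n = fps_nth (odd_sq_series + sq_series ^ 4) n"
    unfolding fps_add_nth 4 by (auto simp: sq_series_def odd_sq_series_def)
qed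

section \<open>Residue classes of exponents modulo 8\<close>

definition supported_mod8 :: "nat \<Rightarrow> bit fps \<Rightarrow> bool" where
  "supported_mod8 r f \<longleftrightarrow> (\<forall>n. fps_nth f n \<noteq> 0 \<longrightarrow> [n = r] (mod 8))"

definition section3 :: "bit fps \<Rightarrow> bit fps" where
  "section3 f = Abs_fps (\<lambda>n. if [n = 3] (mod 8) then fps_nth f n else 0)"

lemma section3_add: "section3 (f + g) = section3 f + section3 g"
  by (rule fps_ext) (simp add: section3_def)

lemma section3_supported: "supported_mod8 r f \<Longrightarrow> section3 f = (if [r = 3] (mod 8) then f else 0)"
  by (rule fps_ext) (auto simp: section3_def supported_mod8_def Cong.cong_def)

lemma supported_mod8_mult:
  assumes "supported_mod8 r f" "supported_mod8 s g"
  shows "supported_mod8 (r + s) (f * g)"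
  unfolding supported_mod8_def
proof (intro allI impI)
  fix n assume "fps_nth (f * g) n \<noteq> 0"
  then have "(\<Sum>i=0..n. fps_nth f i * fps_nth g (n - i)) \<noteq> 0" unfolding fps_mult_nth .
  then obtain i where "i \<in> {0..n}" and nz: "fps_nth f i * fps_nth g (n - i) \<noteq> 0"
    by (rule sum.not_neutral_contains_not_neutral)
  then have i: "i \<le> n" by simp
  then have "[i + (n - i) = r + s] (mod 8)"
    using assms nz unfolding supported_mod8_def by (intro cong_add) (metis mult_zero_left mult_zero_right)+
  then show "[n = r + s] (mod 8)" using i by simp
qed

lemma supported_mod8_square:
  assumes "supported_mod8 r f"
  shows "supported_mod8 (2 * r) (f\<^sup>2)"
  using supported_mod8_mult[OF assms assms] by (simp only: power2_eq_square mult_2)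

text \<open>Multiplying by a series in \<open>x^8\<close> does not move exponents between residue
  classes.\<close>

lemma section3_mult:
  assumes "supported_mod8 0 g"
  shows "section3 (f * g) = section3 f * g"
proof (rule fps_ext)
  fix n
  have "(if [n = 3] (mod 8) then fps_nth f i * fps_nth g (n - i) else 0) =
      (if [i = 3] (mod 8) then fps_nth f i else 0) * fps_nth g (n - i)" if i: "i \<le> n" for i
  proof (cases "fps_nth g (n - i) = 0")
    case False
    then have "[n - i = 0] (mod 8)" using assms by (simp add: supported_mod8_def)
    then have "[i + (n - i) = i + 0] (mod 8)" by (intro cong_add) auto
    then have "[n = i] (mod 8)" using i by simp
    then have "[n = 3] (mod 8) \<longleftrightarrow> [i = 3] (mod 8)" by (auto simp: Cong.cong_def)
    then show ?thesis by simp
  qed simp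
  then have "(\<Sum>i=0..n. if [n = 3] (mod 8) then fps_nth f i * fps_nth g (n - i) else 0) =
      (\<Sum>i=0..n. (if [i = 3] (mod 8) then fps_nth f i else 0) * fps_nth g (n - i))"
    by (intro sum.cong) auto
  then show "fps_nth (section3 (f * g)) n = fps_nth (section3 f * g) n"
    by (cases "[n = 3] (mod 8)") (simp_all add: section3_def fps_mult_nth)
qed

lemma supported_mod8_odd_sq_series: "supported_mod8 1 odd_sq_series"
  unfolding supported_mod8_def
proof (intro allI impI)
  fix n assume "fps_nth odd_sq_series n \<noteq> 0"
  then obtain a where a: "odd a" "n = a\<^sup>2" by (auto simp: odd_sq_series_def split: if_splits)
  obtain k where k: "a = 2 * k + 1" using a(1) oddE by blast
  have "even (k * (k + 1))" by simp
  then obtain t where t: "k * (k + 1) = 2 * t" by (rule evenE)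
  have "n = 4 * (k * (k + 1)) + 1" unfolding a(2) k by (simp add: power2_eq_square algebra_simps)
  then show "[n = 1] (mod 8)" unfolding t by (simp add: Cong.cong_def)
qed

lemma supported_mod8_sq_series_power8: "supported_mod8 0 (sq_series ^ 8)"
proof -
  have "sq_series ^ 8 = ((sq_series\<^sup>2)\<^sup>2)\<^sup>2" by (simp flip: power_mult)
  moreover have "[n = 0] (mod 8)" if "even n \<and> even (n div 2) \<and> even (n div 2 div 2)" for n :: nat
    using that unfolding cong_0_iff by presburger
  moreover have "even n \<and> even (n div 2) \<and> even (n div 2 div 2)"
    if "fps_nth (((sq_series\<^sup>2)\<^sup>2)\<^sup>2) n \<noteq> 0" for n
    using that unfolding bit_fps_nth_square by (simp split: if_split_asm)
  ultimately show ?thesis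
    unfolding supported_mod8_def by simp
qed

text \<open>Expand \<open>1 / g = g\<^sup>7 / g\<^sup>8\<close> using \<open>g = F + g\<^sup>4\<close>; only one term of \<open>g\<^sup>7\<close> lives in degrees 3 mod 8.\<close>
lemma section3_inverse: "section3 (1 / sq_series) = odd_sq_series * odd_sq_series\<^sup>2 * sq_series ^ 8"
proof -
  define g F E G where defs: "g = sq_series" "F = odd_sq_series" "E = g ^ 8" "G = F\<^sup>2"
  have g8: "E = ((g\<^sup>2)\<^sup>2)\<^sup>2" by (simp add: defs flip: power_mult)
  have g1: "g = F + (g\<^sup>2)\<^sup>2"
    unfolding defs(1,2) power4_eq_square_square[symmetric] by (rule sq_series_eq)
  have "g\<^sup>2 = (F + (g\<^sup>2)\<^sup>2)\<^sup>2" using g1 by (rule arg_cong)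
  then have g2: "g\<^sup>2 = G + E" by (simp only: bit_fps_square_add defs(4) g8)
  then have "(g\<^sup>2)\<^sup>2 = (G + E)\<^sup>2" by (rule arg_cong)
  then have g4: "(g\<^sup>2)\<^sup>2 = G\<^sup>2 + E\<^sup>2" by (simp only: bit_fps_square_add)
  have g1': "g = F + (G\<^sup>2 + E\<^sup>2)" using g1 unfolding g4 .
  \<comment> \<open>Splitting 7 into powers of 2 lets additivity of squaring turn each factor into a
    short sum.\<close>
  have "g ^ (1 + 2 + 4) = g * g\<^sup>2 * (g\<^sup>2)\<^sup>2"
    by (simp only: power_add power_one_right power4_eq_square_square)
  also have "\<dots> = g * (G + E) * (G\<^sup>2 + E\<^sup>2)" by (simp only: g4) (simp only: g2)
  also have "\<dots> = (F + (G\<^sup>2 + E\<^sup>2)) * (G + E) * (G\<^sup>2 + E\<^sup>2)" by (subst g1') (rule refl)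
  also have "\<dots> = F * (G + E) * (G\<^sup>2 + E\<^sup>2) + (G + E) * (G\<^sup>2 + E\<^sup>2)\<^sup>2"
    by (simp add: power2_eq_square algebra_simps)
  also have "(G\<^sup>2 + E\<^sup>2)\<^sup>2 = (G\<^sup>2)\<^sup>2 + (E\<^sup>2)\<^sup>2" by (rule bit_fps_square_add)
  finally have "g ^ (1 + 2 + 4) = F * (G + E) * (G\<^sup>2 + E\<^sup>2) + (G + E) * ((G\<^sup>2)\<^sup>2 + (E\<^sup>2)\<^sup>2)" .
  then have g7: "g ^ 7 = F * G * G\<^sup>2 + F * G * E\<^sup>2 + F * E * G\<^sup>2 + F * E * E\<^sup>2 + G * (G\<^sup>2)\<^sup>2
      + G * (E\<^sup>2)\<^sup>2 + E * (G\<^sup>2)\<^sup>2 + E * (E\<^sup>2)\<^sup>2"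
    by (simp add: algebra_simps)
  have F: "supported_mod8 1 F" unfolding defs by (rule supported_mod8_odd_sq_series)
  have G: "supported_mod8 2 G" unfolding defs(4) using supported_mod8_square[OF F] by simp
  have E: "supported_mod8 0 E" unfolding defs by (rule supported_mod8_sq_series_power8)
  note G2 = supported_mod8_square[OF G] and E2 = supported_mod8_square[OF E]
  note sec = supported_mod8_mult[THEN section3_supported]
  \<comment> \<open>With \<open>F\<close>, \<open>G\<close>, \<open>E\<close> in classes 1, 2, 0,
    the eight terms of \<open>g7\<close> lie, in order, in classes 7, 3, 5, 1, 2, 2, 0, 0.\<close>
  have "section3 (F * G * G\<^sup>2) = 0" "section3 (F * E * G\<^sup>2) = 0" "section3 (F * E * E\<^sup>2) = 0"
    "section3 (F * G * E\<^sup>2) = F * G * E\<^sup>2"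
    using sec[OF supported_mod8_mult[OF F G] G2] sec[OF supported_mod8_mult[OF F E] G2]
      sec[OF supported_mod8_mult[OF F E] E2] sec[OF supported_mod8_mult[OF F G] E2]
    by (simp_all add: Cong.cong_def)
  moreover have "section3 (G * (G\<^sup>2)\<^sup>2) = 0" "section3 (G * (E\<^sup>2)\<^sup>2) = 0"
    "section3 (E * (G\<^sup>2)\<^sup>2) = 0" "section3 (E * (E\<^sup>2)\<^sup>2) = 0"
    using sec[OF G supported_mod8_square[OF G2]] sec[OF G supported_mod8_square[OF E2]]
      sec[OF E supported_mod8_square[OF G2]] sec[OF E supported_mod8_square[OF E2]]
    by (simp_all add: Cong.cong_def)
  ultimately have s7: "section3 (g ^ 7) = F * G * E * E"
    unfolding g7 by (simp add: section3_add power2_eq_square mult.assoc)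
  have "g ^ 8 = g * g ^ 7" using power_Suc[of g 7] by simp
  \<comment> \<open>This clears the denominator: \<open>section3\<close> passes through the factor
    \<open>E\<close>, whose exponents are multiples of 8, and \<open>E\<close> cancels at the
    end.\<close>
  then have "1 / g * E = (g * (1 / g)) * g ^ 7" by (simp only: defs(3) ac_simps)
  then have "section3 (1 / g) * E = F * G * E * E"
    using section3_mult[OF E, of "1 / g"] s7 sq_series_mult_inverse by (simp add: defs(1))
  moreover have "E \<noteq> 0" using sq_series_mult_inverse by (auto simp: defs)
  ultimately have "section3 (1 / g) = F * G * E" by simp
  then show ?thesis by (simp add: defs)
qed

section \<open>From representations to positive triples\<close>

definition reps :: "nat \<Rightarrow> ((nat \<times> nat) \<times> nat) set" where
  "reps n = {((a, b), c). odd a \<and> odd b \<and> a\<^sup>2 + 2 * b\<^sup>2 + 8 * c\<^sup>2 = n}"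

lemma B_iff_odd_card_reps:
  assumes "[n = 3] (mod 8)"
  shows "n \<in> B \<longleftrightarrow> odd (card (reps n))"
proof -
  \<comment> \<open>The eighth power is three squarings, so it counts \<open>c\<close> with weight
    \<open>8 c\<^sup>2\<close>; the factors F and its square contribute \<open>a\<^sup>2\<close> and
    \<open>2 b\<^sup>2\<close>.\<close>
  have "counted_by UNIV (\<lambda>c. 2 * (2 * (2 * c\<^sup>2))) (((sq_series\<^sup>2)\<^sup>2)\<^sup>2)"
    by (intro counted_by_square counted_by_sq_series)
  then have 8: "counted_by UNIV (\<lambda>c. 2 * (2 * (2 * c\<^sup>2))) (sq_series ^ 8)"
    by (simp flip: power_mult)
  note * = counted_by_mult[OF counted_by_mult[OF counted_by_odd_sq_series
        counted_by_square[OF counted_by_odd_sq_series]] 8]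
  let ?S = "{p \<in> ({a. odd a} \<times> {a. odd a}) \<times> UNIV.
      (case p of (x, c) \<Rightarrow> (case x of (a, b) \<Rightarrow> a\<^sup>2 + 2 * b\<^sup>2) + 2 * (2 * (2 * c\<^sup>2))) = n}"
  have "fps_nth (section3 (1 / sq_series)) n = of_nat (card ?S)"
    using * unfolding counted_by_def section3_inverse by blast
  also have "?S = reps n" by (simp add: reps_def set_eq_iff split_paired_all)
  finally have "fps_nth (section3 (1 / sq_series)) n = of_nat (card (reps n))" .
  then have "fps_nth (1 / sq_series) n = of_nat (card (reps n))"
    using assms by (simp add: section3_def)
  moreover have "(of_nat k :: bit) = 1 \<longleftrightarrow> odd k" for k by (induction k) auto
  ultimately show ?thesis by (simp add: B_def)
qed

text \<open>Of half the sum and half the difference exactly one is even, as \<open>y\<close> is odd;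
  it becomes \<open>2 * c\<close> and the other one \<open>b\<close>. The absolute value covers both
  cases.\<close>

lemma odd_sum_diff_split:
  fixes y z :: int
  assumes "odd y" "odd z" "0 < z" "z \<le> y"
  obtains b c where "0 \<le> b" "0 \<le> c" "odd b" "y = b + 2 * c" "z = \<bar>b - 2 * c\<bar>"
proof -
  have "even (y + z)" using assms by simp
  then obtain s where s: "y + z = 2 * s" by (rule evenE)
  define t where "t = y - s"
  have yz: "y = s + t" "z = s - t" using s by (simp_all add: t_def)
  have nonneg: "0 \<le> s" "0 \<le> t" using assms yz by linarith+
  show thesis
  proof (cases "even t")
    case True
    then obtain c where "t = 2 * c" by (rule evenE)
    then show ?thesis using that[of s c] assms yz nonneg by auto
  next
    case False
    then have "even s" using assms yz by auto
    then obtain c where "s = 2 * c" by (rule evenE)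
    then show ?thesis using that[of t c] assms yz nonneg False by auto
  qed
qed

text \<open>Rests on \<open>2 b\<^sup>2 + 8 c\<^sup>2 = (b + 2 c)\<^sup>2 + (b - 2
  c)\<^sup>2\<close>, with the larger root listed first.\<close>

lemma bij_betw_reps_pos_triples:
  assumes n: "[n = 3] (mod 8)"
  shows "bij_betw (\<lambda>((a, b), c). Quat 0 (int a) (int b + 2 * int c) \<bar>int b - 2 * int c\<bar>)
    (reps n) {v \<in> pos_triples (int n). q3 v \<le> q2 v}"
    (is "bij_betw ?h _ ?T")
  unfolding bij_betw_def
proof
  show "inj_on ?h (reps n)"
  proof (rule inj_onI, clarsimp simp: reps_def)
    fix b c b' c' :: nat
    assume odd: "odd b" and eq: "int b + 2 * int c = int b' + 2 * int c'"
      and "\<bar>int b - 2 * int c\<bar> = \<bar>int b' - 2 * int c'\<bar>"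
    then consider "int b - 2 * int c = int b' - 2 * int c'" | "int b - 2 * int c = - (int b' - 2 * int c')"
      by (auto simp only: abs_eq_iff)
    then show "b = b' \<and> c = c'"
    proof cases
      \<comment> \<open>Opposite signs would give \<open>b = 2 * c'\<close>, against the oddness of
        \<open>b\<close>.\<close>
      case 2
      then have "int b = int (2 * c')" using eq by simp
      then have "b = 2 * c'" by (simp only: of_nat_eq_iff)
      then show ?thesis using odd by simp
    qed (use eq in simp)
  qed
  have "[int n = 3] (mod 8)" using n cong_int_iff[of n 3 8] by simp
  show "?h ` reps n = ?T"
  proof (intro equalityI subsetI)
    fix v assume "v \<in> ?h ` reps n"
    then obtain a b c where abc: "odd a" "odd b" "a\<^sup>2 + 2 * b\<^sup>2 + 8 * c\<^sup>2 = n"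
      and v: "v = Quat 0 (int a) (int b + 2 * int c) \<bar>int b - 2 * int c\<bar>"
      by (auto simp: reps_def)
    have "qnorm v = (int a)\<^sup>2 + 2 * (int b)\<^sup>2 + 8 * (int c)\<^sup>2"
      unfolding v qnorm_def by (simp add: power2_eq_square algebra_simps)
    also have "\<dots> = int n" using abc(3) by auto
    finally have "qnorm v = int n" .
    moreover have "0 < a" "0 < b" using abc(1,2) by (auto elim: oddE)
    moreover have "int b \<noteq> 2 * int c"
    proof
      assume "int b = 2 * int c"
      then have "even (int b)" by simp
      then show False using abc(2) by simp
    qed
    ultimately show "v \<in> ?T" by (simp add: pos_triples_def v)
  next
    fix v assume v: "v \<in> ?T"
    then have nv: "qnorm v = int n" "q0 v = 0" "0 < q1 v" "0 < q2 v" "0 < q3 v" "q3 v \<le> q2 v"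
      by (simp_all add: pos_triples_def)
    have odd: "odd (q1 v) \<and> odd (q2 v) \<and> odd (q3 v)"
      using nv \<open>[int n = 3] (mod 8)\<close> by (intro int_sum3_squares_odd) (simp add: qnorm_def)
    obtain b c where bc: "0 \<le> b" "0 \<le> c" "odd b" "q2 v = b + 2 * c" "q3 v = \<bar>b - 2 * c\<bar>"
      using odd_sum_diff_split[of "q2 v" "q3 v"] odd nv by blast
    have "int n = (q1 v)\<^sup>2 + 2 * b\<^sup>2 + 8 * c\<^sup>2"
      using nv(2) unfolding nv(1)[symmetric] qnorm_def bc by (simp add: power2_eq_square algebra_simps)
    also have "\<dots> = int ((nat (q1 v))\<^sup>2 + 2 * (nat b)\<^sup>2 + 8 * (nat c)\<^sup>2)"
      using nv bc by simp
    finally have "(nat (q1 v))\<^sup>2 + 2 * (nat b)\<^sup>2 + 8 * (nat c)\<^sup>2 = n"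
      by (simp only: of_nat_eq_iff)
    then have "((nat (q1 v), nat b), nat c) \<in> reps n"
      using odd bc nv by (simp add: reps_def even_nat_iff)
    moreover have "v = ?h ((nat (q1 v), nat b), nat c)"
      using bc nv by (simp add: quat_eq_iff)
    ultimately show "v \<in> ?h ` reps n" by blast
  qed
qed

text \<open>\<open>reps n\<close> corresponds to the triples with \<open>q3 v \<le> q2 v\<close>,
  and \<open>qswap\<close> exchanges the two strict orders, so doubling counts every triple once and
  the diagonal ones once more.\<close>

lemma card_reps:
  assumes "[n = 3] (mod 8)"
  shows "2 * card (reps n) =
    card (pos_triples (int n)) + card {v \<in> pos_triples (int n). q2 v = q3 v}"
proof -
  let ?S = "pos_triples (int n)"
  let ?L = "{v \<in> ?S. q3 v < q2 v}" and ?E = "{v \<in> ?S. q2 v = q3 v}" and ?G = "{v \<in> ?S. q2 v < q3 v}"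
  have "bij_betw qswap ?L ?G"
    by (rule bij_betw_byWitness[of _ qswap]) (auto simp: qswap_in_pos_triples, auto simp: qswap_def)
  then have LG: "card ?L = card ?G" by (rule bij_betw_same_card)
  have LE: "card ?L + card ?E = card (reps n)"
  proof -
    have "card (reps n) = card {v \<in> ?S. q3 v \<le> q2 v}"
      by (rule bij_betw_same_card[OF bij_betw_reps_pos_triples[OF assms]])
    also have "{v \<in> ?S. q3 v \<le> q2 v} = ?L \<union> ?E" by auto
    also have "card \<dots> = card ?L + card ?E" by (rule card_Un_disjoint) auto
    finally show ?thesis ..
  qed
  have "?S = (?L \<union> ?E) \<union> ?G" by auto
  then have "card ?S = card ((?L \<union> ?E) \<union> ?G)" by (rule arg_cong)
  also have "\<dots> = card (?L \<union> ?E) + card ?G" by (rule card_Un_disjoint) auto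
  also have "card (?L \<union> ?E) = card ?L + card ?E" by (rule card_Un_disjoint) auto
  finally show ?thesis using LG LE by simp
qed

section \<open>Integers with three primes of odd multiplicity\<close>

lemma not_square_if_odd_multiplicity:
  fixes m :: nat
  assumes "prime p" "odd (multiplicity p m)"
  shows "\<not> (\<exists>k. int m = k\<^sup>2)"
proof
  assume "\<exists>k. int m = k\<^sup>2"
  then obtain k where "int m = k\<^sup>2" by blast
  then have "int m = int ((nat \<bar>k\<bar>)\<^sup>2)" by simp
  then have m: "m = (nat \<bar>k\<bar>)\<^sup>2" by (simp only: of_nat_eq_iff)
  show False
  proof (cases "k = 0")
    case True
    then show False using assms(2) m by simp
  next
    case False
    then have "multiplicity p m = 2 * multiplicity p (nat \<bar>k\<bar>)"
      unfolding m using assms(1) by (intro prime_elem_multiplicity_power_distrib) auto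
    then show False using assms(2) by simp
  qed
qed

text \<open>The factors are the full powers \<open>c\<close> of \<open>p\<close> and
  \<open>d\<close> of \<open>q\<close>, and the rest \<open>e\<close>, in which \<open>r\<close>
  keeps its odd multiplicity.\<close>

lemma not_in_B_if_three_odd_multiplicities:
  fixes n :: nat
  assumes n: "[n = 3] (mod 8)" and pr: "prime p" "prime q" "prime r"
    and ne: "p \<noteq> q" "p \<noteq> r" "q \<noteq> r"
    and odd: "odd (multiplicity p n)" "odd (multiplicity q n)" "odd (multiplicity r n)"
  shows "n \<notin> B"
proof -
  have n0: "n \<noteq> 0" using n by (auto simp: Cong.cong_def)
  define c where "c = p ^ multiplicity p n"
  obtain m where m: "n = c * m" "\<not> p dvd m"
    using multiplicity_decompose'[of n p] n0 pr unfolding c_def by (metis mult.commute not_prime_unit)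
  have m0: "m \<noteq> 0" using n0 m by auto
  define d where "d = q ^ multiplicity q m"
  obtain e where e: "m = d * e" "\<not> q dvd e"
    using multiplicity_decompose'[of m q] m0 pr unfolding d_def by (metis mult.commute not_prime_unit)
  have e0: "e \<noteq> 0" using m0 e by auto
  have c0: "c \<noteq> 0" "d \<noteq> 0" using m(1) e(1) n0 by auto
  have npe: "\<not> p dvd e" "\<not> p dvd d" using m(2) e(1) by auto
  have cop: "coprime c d" "coprime c e" "coprime d e"
    unfolding c_def d_def using ne pr npe e(2) primes_coprime[of p q]
    by (simp_all add: prime_imp_coprime)
  have mult_n: "multiplicity x n = multiplicity x c + multiplicity x d + multiplicity x e"
    if "prime x" for x
    using c0 e0 that unfolding m(1) e(1) by (simp add: prime_elem_multiplicity_mult_distrib)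
  have npow: "\<not> x dvd y ^ k" if "prime x" "prime y" "x \<noteq> y" for x y k :: nat
    using that prime_dvd_power primes_dvd_imp_eq by blast
  have z: "multiplicity p d = 0" "multiplicity p e = 0" "multiplicity q c = 0" "multiplicity q e = 0"
    "multiplicity r c = 0" "multiplicity r d = 0"
    using npe e(2) ne pr npow unfolding c_def d_def
    by (auto intro!: not_dvd_imp_multiplicity_0)
  have mc: "odd (multiplicity p c)" and md: "odd (multiplicity q d)" and me: "odd (multiplicity r e)"
    using odd mult_n pr z by auto
  have nsq: "\<not> (\<exists>k. int c = k\<^sup>2)" "\<not> (\<exists>k. int d = k\<^sup>2)" "\<not> (\<exists>k. int e = k\<^sup>2)"
    using not_square_if_odd_multiplicity mc md me pr by blast+
  \<comment> \<open>The prime \<open>p\<close> shows that \<open>c * d\<close> and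
    \<open>c * e\<close> are not squares, and \<open>q\<close> does so for
    \<open>d * e\<close>.\<close>
  have "odd (multiplicity p (c * d))" "odd (multiplicity p (c * e))" "odd (multiplicity q (d * e))"
    using c0 e0 z mc md pr by (simp_all add: prime_elem_multiplicity_mult_distrib)
  then have nsq2: "\<not> (\<exists>k. int c * int d = k\<^sup>2)" "\<not> (\<exists>k. int c * int e = k\<^sup>2)"
    "\<not> (\<exists>k. int d * int e = k\<^sup>2)"
    using not_square_if_odd_multiplicity pr unfolding of_nat_mult[symmetric] by blast+
  have "[int n = 3] (mod 8)" using n cong_int_iff[of n 3 8] by simp
  moreover have "int n = int c * int d * int e" using m(1) e(1) by simp
  ultimately have "4 dvd card (pos_triples (int n))"
    "4 dvd card {v \<in> pos_triples (int n). q2 v = q3 v}"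
    using four_dvd_card_pos_triples[of "int n" "int c" "int d" "int e"] c0 e0 cop nsq nsq2 by simp_all
  then have "4 dvd 2 * card (reps n)" unfolding card_reps[OF n] by (rule dvd_add)
  then have "even (card (reps n))" by presburger
  then show ?thesis using B_iff_odd_card_reps[OF n] by simp
qed

section \<open>Primes and semiprimes\<close>

lemma prod_primes_dvd:
  fixes N :: nat
  assumes "finite A" "\<And>p. p \<in> A \<Longrightarrow> prime p \<and> p dvd N"
  shows "\<Prod>A dvd N"
  using assms
proof (induction A rule: finite_induct)
  case (insert p A)
  have "coprime p (\<Prod>A)"
    using insert.prems insert.hyps by (intro prod_coprime_right) (metis insert_iff primes_coprime)
  then show ?case using insert by (simp add: divides_mult)
qed simp

text \<open>Primes in \<open>(n, 2 n]\<close> divide the central binomial coefficient, which is at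
  most \<open>2 ^ (2 * n)\<close>, while each exceeds \<open>n = 2 ^ k\<close>; compare exponents of
  2.\<close>

lemma card_primes_dyadic:
  "k * card {p :: nat. prime p \<and> 2 ^ k < p \<and> p \<le> 2 ^ (k + 1)} \<le> 2 ^ (k + 1)"
proof -
  define n :: nat where "n = 2 ^ k"
  define A where "A = {p :: nat. prime p \<and> n < p \<and> p \<le> 2 * n}"
  have fin: "finite A" by (rule finite_subset[of _ "{..2 * n}"]) (auto simp: A_def)
  have "prime p \<and> p dvd (2 * n choose n)" if p: "p \<in> A" for p
  proof -
    have pr: "prime p" and le: "n < p" "p \<le> 2 * n" using p by (simp_all add: A_def)
    have "p dvd fact (2 * n)" using prime_dvd_fact_iff pr le by blast
    also have "fact (2 * n) = fact n * fact n * (2 * n choose n)"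
      using binomial_fact_lemma[of n "2 * n"] by (simp add: mult_2)
    finally have "p dvd fact n \<or> p dvd (2 * n choose n)"
      using pr by (simp add: prime_dvd_mult_iff)
    moreover have "\<not> p dvd fact n" using prime_dvd_fact_iff[OF pr, of n] le by simp
    ultimately show ?thesis using pr by blast
  qed
  then have "\<Prod>A dvd (2 * n choose n)" using prod_primes_dvd[OF fin] by blast
  then have "\<Prod>A \<le> (2 * n choose n)" by (rule dvd_imp_le) simp
  also have "\<dots> \<le> 2 ^ (2 * n)" by (rule binomial_le_pow2)
  finally have "\<Prod>A \<le> 2 ^ (2 * n)" .
  moreover have "n ^ card A \<le> \<Prod>A"
    using prod_mono[of A "\<lambda>_. n" "\<lambda>p. p"] by (auto simp: A_def)
  ultimately have "2 ^ (k * card A) \<le> (2 :: nat) ^ (2 * n)"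
    by (simp add: n_def power_mult)
  then have "k * card A \<le> 2 * n" by simp
  then show ?thesis by (simp add: A_def n_def)
qed

lemma finite_primes_le [simp]: "finite {p :: nat. prime p \<and> p \<le> N}"
  by (rule finite_subset[of _ "{..N}"]) auto

lemma finite_primes_between [simp]: "finite {p :: nat. prime p \<and> M < p \<and> p \<le> N}"
  by (rule finite_subset[of _ "{..N}"]) auto

lemma primes_le_pow2_Suc:
  "{p :: nat. prime p \<and> p \<le> 2 ^ Suc k} =
    {p. prime p \<and> p \<le> 2 ^ k} \<union> {p. prime p \<and> 2 ^ k < p \<and> p \<le> 2 ^ (k + 1)}"
proof -
  have "p \<le> 2 ^ k \<Longrightarrow> p \<le> 2 ^ Suc k" for p :: nat
    using power_increasing[of k "Suc k" "2 :: nat"] by linarith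
  then show ?thesis by auto
qed

lemma card_primes_le_pow2: "k * card {p :: nat. prime p \<and> p \<le> 2 ^ k} \<le> 6 * 2 ^ k"
proof (induction k)
  case (Suc k)
  let ?P = "card {p :: nat. prime p \<and> p \<le> 2 ^ k}"
    and ?N = "card {p :: nat. prime p \<and> 2 ^ k < p \<and> p \<le> 2 ^ (k + 1)}"
  have card: "card {p :: nat. prime p \<and> p \<le> 2 ^ Suc k} \<le> ?P + ?N"
    unfolding primes_le_pow2_Suc by (rule card_Un_le)
  show ?case
  proof (cases "k \<ge> 2")
    case True
    have "Suc k * card {p :: nat. prime p \<and> p \<le> 2 ^ Suc k} \<le> Suc k * (?P + ?N)"
      using card by (rule mult_left_mono) simp
    \<comment> \<open>This is where \<open>2 \<le> k\<close> enters. With a bound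
      \<open>C * 2 ^ k\<close> the induction then needs \<open>3 * (C + 2) \<le> 4 * C\<close>, so 6
      is the least constant for this step.\<close>
    moreover have "2 * Suc k * (?P + ?N) \<le> 3 * k * (?P + ?N)"
      using True by (intro mult_right_mono) auto
    moreover have "3 * k * (?P + ?N) \<le> 3 * (6 * 2 ^ k + 2 ^ (k + 1))"
      using Suc.IH card_primes_dyadic[of k] by (simp add: distrib_left algebra_simps)
    ultimately show ?thesis by simp
  next
    case False
    have "card {p :: nat. prime p \<and> p \<le> 2 ^ Suc k} \<le> card {1..2 ^ Suc k :: nat}"
      by (rule card_mono) (auto dest: prime_ge_1_nat)
    then have "Suc k * card {p :: nat. prime p \<and> p \<le> 2 ^ Suc k} \<le> 6 * 2 ^ Suc k"
      using False by (intro mult_mono) auto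
    then show ?thesis .
  qed
qed simp

section \<open>Sums of reciprocals of primes\<close>

lemma harmonic_sum_le: "0 < K \<Longrightarrow> (\<Sum>k=1..K. 1 / real k) \<le> 1 + ln (real K)"
proof (induction K rule: nat_induct_non_zero)
  case (Suc K)
  \<comment> \<open>The bound \<open>ln t \<le> t - 1\<close> compares each term with an increment
    of the logarithm.\<close>
  have "ln (real K / real (Suc K)) \<le> real K / real (Suc K) - 1"
    using Suc.hyps by (intro ln_le_minus_one) simp
  also have "\<dots> = - (1 / real (Suc K))" by (simp add: field_simps)
  finally have "1 / real (Suc K) \<le> ln (real (Suc K)) - ln (real K)"
    using Suc.hyps by (simp add: ln_div)
  then show ?case using Suc.IH by simp
qed simp

text \<open>By \<open>card_primes_dyadic\<close> the primes in \<open>(2 ^ k, 2 ^ (k + 1)]\<close>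
  contribute at most \<open>2 / k\<close>. The leading 1 covers the prime 2.\<close>

lemma sum_inverse_primes_le_pow2:
  "(\<Sum>p | prime p \<and> p \<le> 2 ^ Suc K. 1 / real p) \<le> 1 + 2 * (\<Sum>k=1..K. 1 / real k)"
proof (induction K)
  case 0
  have "{p :: nat. prime p \<and> p \<le> 2 ^ Suc 0} = {2}"
    by (intro equalityI subsetI) (auto intro: le_antisym dest: prime_ge_2_nat)
  then show ?case by simp
next
  case (Suc K)
  let ?k = "Suc K"
  let ?A = "{p :: nat. prime p \<and> p \<le> 2 ^ ?k}"
    and ?D = "{p :: nat. prime p \<and> 2 ^ ?k < p \<and> p \<le> 2 ^ (?k + 1)}"
  have "(\<Sum>p\<in>?D. 1 / real p) \<le> (\<Sum>p\<in>?D. 1 / 2 ^ ?k)"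
  proof (rule sum_mono)
    fix p assume "p \<in> ?D"
    then have "real (2 ^ ?k) \<le> real p" by (intro of_nat_mono) auto
    then show "1 / real p \<le> 1 / 2 ^ ?k" by (intro frac_le) auto
  qed
  also have "\<dots> = real (card ?D) / 2 ^ ?k" by simp
  also have "\<dots> \<le> 2 / real ?k"
  proof -
    have "real (?k * card ?D) \<le> real (2 ^ (?k + 1))"
      using card_primes_dyadic[of ?k] by (rule of_nat_mono)
    then have "real ?k * real (card ?D) \<le> 2 * 2 ^ ?k"
      by (simp only: of_nat_mult) simp
    then show ?thesis by (simp add: divide_simps mult.commute del: of_nat_Suc power_Suc)
  qed
  finally have D: "(\<Sum>p\<in>?D. 1 / real p) \<le> 2 / real ?k" .
  have "(\<Sum>p | prime p \<and> p \<le> 2 ^ Suc ?k. 1 / real p) = (\<Sum>p\<in>?A. 1 / real p) + (\<Sum>p\<in>?D. 1 / real p)"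
    unfolding primes_le_pow2_Suc[of ?k] by (rule sum.union_disjoint) auto
  then show ?case using Suc.IH D by (simp del: of_nat_Suc power_Suc)
qed

text \<open>The exponent is \<open>log 2 x\<close> rounded up. The crude
  \<open>1 / 2 \<le> ln 2 \<le> 1\<close> passes to natural logarithms, and
  \<open>1 \<le> log 2 x\<close> absorbs the rounding.\<close>

lemma dyadic_bounds:
  fixes x :: real
  assumes "2 \<le> x"
  obtains K :: nat where "x \<le> 2 ^ Suc K" "2 ^ Suc K \<le> 2 * x" "ln x \<le> real (Suc K)" "real (Suc K) \<le> 4 * ln x"
proof -
  define j where "j = nat \<lceil>log 2 x\<rceil>"
  have l1: "1 \<le> log 2 x" using assms by (simp add: le_log_iff)
  have j: "log 2 x \<le> real j" "real j < log 2 x + 1"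
    unfolding j_def using l1 by linarith+
  have ln2: "1 / 2 \<le> ln (2 :: real)" "ln (2 :: real) \<le> 1"
    using ln_le_minus_one[of "1 / 2 :: real"] ln_le_minus_one[of "2 :: real"] by (simp_all add: ln_div)
  obtain K where K: "j = Suc K" using j l1 by (cases j) auto
  have x: "2 powr log 2 x = x" using assms by simp
  have "2 powr log 2 x \<le> 2 powr real j" "2 powr real j \<le> 2 powr (log 2 x + 1)"
    using j by (intro powr_mono; simp)+
  then have 1: "x \<le> 2 ^ j" "2 ^ j \<le> 2 * x" unfolding powr_add x by (simp_all add: powr_realpow)
  have lx: "0 < ln x" "log 2 x * ln 2 = ln x" using assms by (simp_all add: log_def)
  have 2: "ln x \<le> real j"
    using lx ln2 j l1 mult_left_mono[of "ln 2" 1 "log 2 x"] by simp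
  have "real j \<le> 2 * log 2 x" using j l1 by linarith
  also have "\<dots> \<le> 4 * ln x"
    using lx ln2 l1 mult_left_mono[of "1 / 2" "ln 2" "log 2 x"] by simp
  finally show thesis using that[of K] 1 2 K by simp
qed

lemma card_primes_le:
  fixes x :: real
  assumes "2 \<le> x"
  shows "real (card {p :: nat. prime p \<and> real p \<le> x}) \<le> 12 * x / ln x"
proof -
  obtain K :: nat where K: "x \<le> 2 ^ Suc K" "2 ^ Suc K \<le> 2 * x" "ln x \<le> real (Suc K)"
    using dyadic_bounds[OF assms] by metis
  let ?c = "card {p :: nat. prime p \<and> real p \<le> x}"
  have lx: "0 < ln x" using assms by simp
  have "?c \<le> card {p :: nat. prime p \<and> p \<le> 2 ^ Suc K}"
  proof (rule card_mono)
    show "{p :: nat. prime p \<and> real p \<le> x} \<subseteq> {p. prime p \<and> p \<le> 2 ^ Suc K}"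
    proof clarify
      fix p :: nat assume "real p \<le> x"
      then have "real p \<le> real (2 ^ Suc K)" using K(1) by simp
      then show "p \<le> 2 ^ Suc K" by (simp only: of_nat_le_iff)
    qed
  qed simp
  then have "Suc K * ?c \<le> 6 * 2 ^ Suc K"
    using card_primes_le_pow2[of "Suc K"] by (meson le_trans mult_le_mono2)
  then have "real (Suc K * ?c) \<le> real (6 * 2 ^ Suc K)" by (rule of_nat_mono)
  then have "real (Suc K) * real ?c \<le> 6 * 2 ^ Suc K" by (simp only: of_nat_mult) simp
  \<comment> \<open>The constant 12 is the 6 of \<open>card_primes_le_pow2\<close> times 2 from
    rounding up to a power of 2.\<close>
  then have "real (Suc K) * real ?c \<le> 12 * x" using K(2) by linarith
  moreover have "ln x * real ?c \<le> real (Suc K) * real ?c" using K(3) by (rule mult_right_mono) simp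
  ultimately show ?thesis using lx by (simp add: field_simps)
qed

lemma finite_nat_le_real [simp]: "finite {n :: nat. P n \<and> real n \<le> x}"
  by (rule finite_subset[of _ "{..nat \<lfloor>x\<rfloor>}"]) (auto simp: le_nat_floor)

lemma sum_inverse_primes_le:
  fixes x :: real
  assumes "2 \<le> x"
  shows "(\<Sum>p | prime p \<and> real p \<le> x. 1 / real p) \<le> 9 + 2 * ln (ln x)"
proof -
  obtain K :: nat where K: "x \<le> 2 ^ Suc K" "real (Suc K) \<le> 4 * ln x"
    using dyadic_bounds[OF assms] by metis
  have lx: "0 < ln x" using assms by simp
  have "(\<Sum>p | prime p \<and> real p \<le> x. 1 / real p) \<le> (\<Sum>p | prime p \<and> p \<le> 2 ^ Suc K. 1 / real p)"
  proof (rule sum_mono2)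
    show "{p :: nat. prime p \<and> real p \<le> x} \<subseteq> {p. prime p \<and> p \<le> 2 ^ Suc K}"
    proof clarify
      fix p :: nat assume "real p \<le> x"
      then have "real p \<le> real (2 ^ Suc K)" using K(1) by simp
      then show "p \<le> 2 ^ Suc K" by (simp only: of_nat_le_iff)
    qed
  qed auto
  also have "\<dots> \<le> 1 + 2 * (\<Sum>k=1..K. 1 / real k)" by (rule sum_inverse_primes_le_pow2)
  also have "\<dots> \<le> 1 + 2 * (\<Sum>k=1..Suc K. 1 / real k)" by simp
  also have "\<dots> \<le> 1 + 2 * (1 + ln (real (Suc K)))"
    using harmonic_sum_le[of "Suc K"] by simp
  also have "ln (real (Suc K)) \<le> ln (4 * ln x)" using K(2) lx by (subst ln_le_cancel_iff) auto
  also have "ln (4 * ln x) = ln 4 + ln (ln x)" using lx by (simp add: ln_mult)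
  \<comment> \<open>The constant becomes \<open>1 + 2 * (1 + 3) = 9\<close>.\<close>
  also have "ln (4 :: real) \<le> 3" using ln_le_minus_one[of "4 :: real"] by simp
  finally show ?thesis by simp
qed

section \<open>Counting primes and semiprimes\<close>

definition prime_or_semiprime :: "nat \<Rightarrow> bool" where
  "prime_or_semiprime s \<longleftrightarrow> prime s \<or> (\<exists>p q. prime p \<and> prime q \<and> s = p * q)"

text \<open>The smaller factor \<open>p\<close> of a semiprime is at most \<open>sqrt x\<close>.
  Then \<open>x / p\<close> is at least \<open>sqrt x\<close>, so its logarithm is at least half of
  \<open>ln x\<close> and there are at most \<open>24 x / (p ln x)\<close> choices for the other
  factor; summing over \<open>p\<close> brings in \<open>ln (ln x)\<close>.\<close>

lemma card_prime_or_semiprime_le: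
  fixes x :: real
  assumes x: "4 \<le> x"
  shows "real (card {s. prime_or_semiprime s \<and> real s \<le> x}) \<le> x / ln x * (228 + 48 * ln (ln x))"
proof -
  let ?P = "{p :: nat. prime p \<and> real p \<le> sqrt x}"
  let ?Q = "\<lambda>p. {q :: nat. prime q \<and> real q \<le> x / real p}"
  have lx: "0 < ln x" using x by simp
  have finP: "finite ?P" by simp
  have "{s. prime_or_semiprime s \<and> real s \<le> x} \<subseteq>
      {p. prime p \<and> real p \<le> x} \<union> (\<Union>p\<in>?P. (*) p ` ?Q p)"
  proof
    fix s assume "s \<in> {s. prime_or_semiprime s \<and> real s \<le> x}"
    then have le: "real s \<le> x" and "prime s \<or> (\<exists>p q. prime p \<and> prime q \<and> s = p * q)"
      by (auto simp: prime_or_semiprime_def)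
    then consider "prime s" | p q where "prime p" "prime q" "s = p * q" "p \<le> q"
      by (metis linear mult.commute)
    then show "s \<in> {p. prime p \<and> real p \<le> x} \<union> (\<Union>p\<in>?P. (*) p ` ?Q p)"
    proof cases
      case (2 p q)
      have "real p * real p \<le> real p * real q" using 2(4) by (intro mult_left_mono) auto
      then have "(real p)\<^sup>2 \<le> x" using le 2(3) by (simp add: power2_eq_square)
      then have "real p \<le> sqrt x" by (rule real_le_rsqrt)
      moreover have "real q \<le> x / real p"
        using le 2 prime_gt_0_nat[of p] by (simp add: field_simps)
      ultimately show ?thesis using 2 by blast
    qed (use le in simp)
  qed
  then have "card {s. prime_or_semiprime s \<and> real s \<le> x} \<le>
      card ({p. prime p \<and> real p \<le> x} \<union> (\<Union>p\<in>?P. (*) p ` ?Q p))"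
    by (rule card_mono[rotated]) simp
  also have "\<dots> \<le> card {p :: nat. prime p \<and> real p \<le> x} + card (\<Union>p\<in>?P. (*) p ` ?Q p)"
    by (rule card_Un_le)
  also have "card (\<Union>p\<in>?P. (*) p ` ?Q p) \<le> (\<Sum>p\<in>?P. card ((*) p ` ?Q p))"
    by (rule card_UN_le) simp
  also have "\<dots> \<le> (\<Sum>p\<in>?P. card (?Q p))" by (intro sum_mono card_image_le) simp
  finally have "real (card {s. prime_or_semiprime s \<and> real s \<le> x}) \<le>
      real (card {p :: nat. prime p \<and> real p \<le> x}) + (\<Sum>p\<in>?P. real (card (?Q p)))"
    by (simp flip: of_nat_sum of_nat_add)
  also have "(\<Sum>p\<in>?P. real (card (?Q p))) \<le> (\<Sum>p\<in>?P. 24 * x / ln x * (1 / real p))"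
  proof (rule sum_mono)
    fix p assume p: "p \<in> ?P"
    then have p0: "0 < real p" by (auto dest: prime_gt_0_nat)
    have "sqrt x * real p \<le> sqrt x * sqrt x" using p x by (intro mult_left_mono) auto
    then have sx: "sqrt x \<le> x / real p" using p0 x by (simp add: field_simps)
    have "2 \<le> sqrt x" using x by (intro real_le_rsqrt) simp
    have "ln x / 2 = ln (sqrt x)" using x by (simp add: ln_sqrt)
    also have "\<dots> \<le> ln (x / real p)" using sx x p0 by (subst ln_le_cancel_iff) auto
    finally have l: "ln x / 2 \<le> ln (x / real p)" .
    have "real (card (?Q p)) \<le> 12 * (x / real p) / ln (x / real p)"
      using sx \<open>2 \<le> sqrt x\<close> by (intro card_primes_le) simp
    also have "\<dots> \<le> 12 * (x / real p) / (ln x / 2)"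
      using l lx p0 x by (intro frac_le) auto
    finally show "real (card (?Q p)) \<le> 24 * x / ln x * (1 / real p)" by (simp add: mult.commute)
  qed
  also have "\<dots> = 24 * x / ln x * (\<Sum>p\<in>?P. 1 / real p)" by (simp only: sum_distrib_left)
  finally have le: "real (card {s. prime_or_semiprime s \<and> real s \<le> x}) \<le>
      real (card {p :: nat. prime p \<and> real p \<le> x}) + 24 * x / ln x * (\<Sum>p\<in>?P. 1 / real p)"
    by simp
  have "(\<Sum>p\<in>?P. 1 / real p) \<le> (\<Sum>p | prime p \<and> real p \<le> x. 1 / real p)"
  proof (rule sum_mono2)
    have "sqrt x \<le> x" using x by (intro real_le_lsqrt) (auto simp: power2_eq_square)
    then show "?P \<subseteq> {p. prime p \<and> real p \<le> x}" by auto
  qed auto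
  also have "\<dots> \<le> 9 + 2 * ln (ln x)" using x by (intro sum_inverse_primes_le) simp
  finally have "24 * x / ln x * (\<Sum>p\<in>?P. 1 / real p) \<le> 24 * x / ln x * (9 + 2 * ln (ln x))"
    using x lx by (intro mult_left_mono) auto
  moreover have "real (card {p :: nat. prime p \<and> real p \<le> x}) \<le> 12 * x / ln x"
    using x by (intro card_primes_le) simp
  \<comment> \<open>Here \<open>228 = 12 + 24 * 9\<close> and \<open>48 = 24 * 2\<close>.\<close>
  moreover have "12 * x / ln x + 24 * x / ln x * (9 + 2 * ln (ln x)) = x / ln x * (228 + 48 * ln (ln x))"
    by (simp add: algebra_simps add_divide_distrib)
  ultimately show ?thesis using le by linarith
qed

text \<open>Telescoping, from \<open>1 / (m + 1)\<^sup>2 \<le> 1 / m - 1 / (m + 1)\<close>.\<close>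

lemma sum_inverse_squares_tail:
  assumes "0 < N" "N \<le> M"
  shows "(\<Sum>m\<in>{N<..M}. 1 / (real m)\<^sup>2) \<le> 1 / real N - 1 / real M"
  using assms(2)
proof (induction M rule: dec_induct)
  case (step M)
  have M: "0 < real M" using step.hyps assms(1) by simp
  have "{N<..Suc M} = insert (Suc M) {N<..M}" using step.hyps by auto
  moreover have "1 / (real (Suc M))\<^sup>2 \<le> 1 / real M - 1 / real (Suc M)"
  proof -
    have "1 / real M - 1 / real (Suc M) = 1 / (real M * real (Suc M))"
      using M by (simp add: field_simps)
    moreover have "1 / (real (Suc M))\<^sup>2 \<le> 1 / (real M * real (Suc M))"
      using M by (intro divide_left_mono) (auto simp: power2_eq_square)
    ultimately show ?thesis by simp
  qed
  ultimately show ?case using step.IH by simp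
qed simp

section \<open>The counting bound\<close>

lemma square_not_cong_3: "\<not> [k\<^sup>2 = 3] (mod (8 :: nat))"
proof
  assume "[k\<^sup>2 = 3] (mod 8)"
  then have k: "k\<^sup>2 mod 8 = 3" by (simp add: Cong.cong_def)
  show False
  proof (cases "even k")
    case True
    then have "even (k\<^sup>2)" by simp
    then show False using k by presburger
  next
    case False
    then obtain j where "k = 2 * j + 1" by (rule oddE)
    then have "k\<^sup>2 = 4 * (j * j + j) + 1" by (simp add: power2_eq_square algebra_simps)
    then show False using k by presburger
  qed
qed

text \<open>Take for \<open>s\<close> the squarefree part, whose primes are those of odd
  multiplicity in \<open>n\<close>. Three of them would exclude \<open>n\<close> from
  \<open>B\<close>, and \<open>s = 1\<close> would make \<open>n\<close> a square, which is never 3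
  modulo 8.\<close>

lemma B_cong_3_obtain:
  assumes "n \<in> B" "[n = 3] (mod 8)"
  obtains s m where "prime_or_semiprime s" "n = s * m\<^sup>2"
proof -
  define s where "s = squarefree_part n"
  have n: "n = s * (square_part n)\<^sup>2" unfolding s_def by (rule squarefree_decompose)
  have sf: "squarefree s" unfolding s_def by (rule squarefree_squarefree_part)
  have odd: "odd (multiplicity x n)" if "prime x" "x dvd s" for x
  proof -
    have "0 < multiplicity x s"
      using that prime_multiplicity_gt_zero_iff[of x s] by (simp add: s_def)
    then show ?thesis
      unfolding s_def prime_multiplicity_squarefree_part[OF that(1)] by presburger
  qed
  have sq: "x \<noteq> y" if "prime x" "x * y dvd s" for x y
    using squarefreeD[OF sf, of x] that by (auto simp: power2_eq_square)
  have "s \<noteq> 1" using n assms(2) square_not_cong_3[of "square_part n"] by auto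
  then obtain p where p: "prime p" "p dvd s" using prime_factor_nat by blast
  then obtain t where t: "s = p * t" by blast
  have "prime_or_semiprime s"
  proof (cases "t = 1")
    case True
    then show ?thesis using p t by (simp add: prime_or_semiprime_def)
  next
    case False
    then obtain q where q: "prime q" "q dvd t" using prime_factor_nat by blast
    then obtain u where u: "t = q * u" by blast
    show ?thesis
    proof (cases "u = 1")
      case True
      then show ?thesis using p q t u by (auto simp: prime_or_semiprime_def)
    next
      case False
      then obtain r where r: "prime r" "r dvd u" using prime_factor_nat by blast
      then obtain w where w: "u = r * w" by blast
      have s: "s = p * q * (r * w)" "s = p * r * (q * w)" "s = q * r * (p * w)"
        unfolding t u w by (simp_all add: ac_simps)
      then have "p \<noteq> q" "p \<noteq> r" "q \<noteq> r" "p dvd s" "q dvd s" "r dvd s"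
        using sq p(1) q(1) by (metis dvd_triv_left mult.assoc mult.left_commute)+
      then have "n \<notin> B"
        using not_in_B_if_three_odd_multiplicities[OF assms(2) p(1) q(1) r(1)] odd p q r by blast
      then show ?thesis using assms(1) by blast
    qed
  qed
  then show thesis using that n by blast
qed

text \<open>Serves the large \<open>m\<close> in the next lemma, where \<open>y / m\<^sup>2\<close>
  may be too small for the logarithmic bound.\<close>

lemma card_prime_or_semiprime_trivial:
  assumes "0 \<le> x"
  shows "real (card {s. prime_or_semiprime s \<and> real s \<le> x}) \<le> x"
proof -
  have "{s. prime_or_semiprime s \<and> real s \<le> x} \<subseteq> {1..nat \<lfloor>x\<rfloor>}"
    by (auto simp: prime_or_semiprime_def le_nat_floor Suc_le_eq dest: prime_gt_0_nat)
  then have "card {s. prime_or_semiprime s \<and> real s \<le> x} \<le> card {1..nat \<lfloor>x\<rfloor>}"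
    by (rule card_mono[rotated]) simp
  then show ?thesis using assms by simp linarith
qed

text \<open>Split at \<open>m\<close> about the fourth root of \<open>y\<close>. Below it
  \<open>y / m\<^sup>2\<close> is at least \<open>sqrt y\<close>, so the logarithm loses only a
  factor 2; above it the trivial bound suffices. The 4 is that 2 times the bound 2 for the sum of
  inverse squares.\<close>

lemma card_prime_or_semiprime_times_square:
  fixes y :: real
  assumes y: "16 \<le> y"
  shows "real (card {n. (\<exists>s m. prime_or_semiprime s \<and> n = s * m\<^sup>2 \<and> 0 < m) \<and> real n \<le> y})
    \<le> 4 * (228 + 48 * ln (ln y)) * y / ln y + 2 * y / sqrt (sqrt y)"
proof -
  define M where "M = nat \<lfloor>y\<rfloor>"
  define N where "N = nat \<lfloor>sqrt (sqrt y)\<rfloor>"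
  define W where "W = 228 + 48 * ln (ln y)"
  let ?K = "\<lambda>x. {s. prime_or_semiprime s \<and> real s \<le> x}"
  let ?S = "{n. (\<exists>s m. prime_or_semiprime s \<and> n = s * m\<^sup>2 \<and> 0 < m) \<and> real n \<le> y}"
  have r4: "4 \<le> sqrt y" using y by (intro real_le_rsqrt) simp
  then have r2: "2 \<le> sqrt (sqrt y)" using y by (intro real_le_rsqrt) simp
  have N: "real N \<le> sqrt (sqrt y)" "sqrt (sqrt y) \<le> 2 * real N" "0 < N"
    unfolding N_def using r2 by linarith+
  \<comment> \<open>Arguments from 4 on exceed e, which keeps the iterated logarithms
    non-negative.\<close>
  have ln_ge_1: "1 \<le> ln x" if "4 \<le> x" for x :: real
  proof -
    have "exp 1 \<le> x" using exp_le that by linarith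
    then show ?thesis using that by (simp add: ln_ge_iff)
  qed
  have ly: "1 \<le> ln y" using ln_ge_1 y by simp
  have sqrt_le: "sqrt t \<le> t" if "4 \<le> t" for t :: real
    using that by (intro real_le_lsqrt) (auto simp: power2_eq_square)
  have "sqrt (sqrt y) \<le> y" using sqrt_le[OF r4] sqrt_le[of y] y by linarith
  then have "N \<le> M" unfolding N_def M_def using y by (intro nat_mono floor_mono) simp
  have "?S \<subseteq> (\<Union>m\<in>{1..M}. (\<lambda>s. s * m\<^sup>2) ` ?K (y / (real m)\<^sup>2))"
  proof
    fix n assume "n \<in> ?S"
    then obtain s m where sm: "prime_or_semiprime s" "n = s * m\<^sup>2" "0 < m" "real n \<le> y" by blast
    have "0 < s" using sm(1) by (auto simp: prime_or_semiprime_def dest: prime_gt_0_nat)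
    have "m * 1 \<le> m * (m * s)" using sm(3) \<open>0 < s\<close> by (intro mult_left_mono) auto
    then have "m \<le> n" using sm(2) by (simp add: power2_eq_square ac_simps)
    then have "real m \<le> y" using sm(4) by simp
    then have "m \<in> {1..M}" using sm(3) by (simp add: M_def le_nat_floor Suc_le_eq)
    moreover have "real s \<le> y / (real m)\<^sup>2" using sm(2-4) by (simp add: field_simps)
    ultimately show "n \<in> (\<Union>m\<in>{1..M}. (\<lambda>s. s * m\<^sup>2) ` ?K (y / (real m)\<^sup>2))"
      using sm(1,2) by blast
  qed
  then have "card ?S \<le> card (\<Union>m\<in>{1..M}. (\<lambda>s. s * m\<^sup>2) ` ?K (y / (real m)\<^sup>2))"
    by (rule card_mono[rotated]) simp
  also have "\<dots> \<le> (\<Sum>m\<in>{1..M}. card ((\<lambda>s. s * m\<^sup>2) ` ?K (y / (real m)\<^sup>2)))"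
    by (rule card_UN_le) simp
  also have "\<dots> \<le> (\<Sum>m\<in>{1..M}. card (?K (y / (real m)\<^sup>2)))"
    by (intro sum_mono card_image_le) simp
  finally have "real (card ?S) \<le> (\<Sum>m\<in>{1..M}. real (card (?K (y / (real m)\<^sup>2))))"
    by (simp flip: of_nat_sum)
  also have "{1..M} = {1..N} \<union> {N<..M}" using N \<open>N \<le> M\<close> by auto
  also have "(\<Sum>m\<in>{1..N} \<union> {N<..M}. real (card (?K (y / (real m)\<^sup>2)))) =
      (\<Sum>m\<in>{1..N}. real (card (?K (y / (real m)\<^sup>2)))) + (\<Sum>m\<in>{N<..M}. real (card (?K (y / (real m)\<^sup>2))))"
    by (rule sum.union_disjoint) auto
  also have "(\<Sum>m\<in>{1..N}. real (card (?K (y / (real m)\<^sup>2)))) \<le> (\<Sum>m\<in>{1..N}. 2 * W * y / ln y * (1 / (real m)\<^sup>2))"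
  proof (rule sum_mono)
    fix m assume m: "m \<in> {1..N}"
    let ?x = "y / (real m)\<^sup>2"
    have m0: "1 \<le> real m" using m by simp
    have "real m \<le> sqrt (sqrt y)" using m N(1) by (simp add: order_trans[OF of_nat_mono])
    then have "(real m)\<^sup>2 \<le> (sqrt (sqrt y))\<^sup>2" by (rule power_mono) simp
    then have "(real m)\<^sup>2 \<le> sqrt y" using y by simp
    then have "sqrt y * (real m)\<^sup>2 \<le> sqrt y * sqrt y" using y by (intro mult_left_mono) auto
    then have x: "sqrt y \<le> ?x" using m0 y by (simp add: field_simps)
    have x4: "4 \<le> ?x" using x r4 by (rule order_trans[rotated])
    have "?x \<le> y / 1" using m0 y by (intro divide_left_mono) auto
    then have xy: "?x \<le> y" by simp
    have lx: "1 \<le> ln ?x" using ln_ge_1 x4 by blast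
    have "ln y / 2 = ln (sqrt y)" using y by (simp add: ln_sqrt)
    also have "\<dots> \<le> ln ?x" using x y m0 by (subst ln_le_cancel_iff) auto
    finally have lxy: "ln y / 2 \<le> ln ?x" .
    have "ln ?x \<le> ln y" using xy y m0 by (subst ln_le_cancel_iff) auto
    then have "ln (ln ?x) \<le> ln (ln y)" using lx by (subst ln_le_cancel_iff) auto
    then have W: "228 + 48 * ln (ln ?x) \<le> W" "0 \<le> 228 + 48 * ln (ln ?x)"
      using lx by (simp_all add: W_def)
    have "real (card (?K ?x)) \<le> ?x / ln ?x * (228 + 48 * ln (ln ?x))"
      using x4 by (rule card_prime_or_semiprime_le)
    also have "\<dots> \<le> ?x / (ln y / 2) * W"
      using W lx lxy ly y m0 by (intro mult_mono frac_le) auto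
    finally show "real (card (?K ?x)) \<le> 2 * W * y / ln y * (1 / (real m)\<^sup>2)"
      by (simp add: mult_ac)
  qed
  also have "\<dots> = 2 * W * y / ln y * (\<Sum>m\<in>{1..N}. 1 / (real m)\<^sup>2)"
    by (simp only: sum_distrib_left)
  also have "(\<Sum>m\<in>{N<..M}. real (card (?K (y / (real m)\<^sup>2)))) \<le> (\<Sum>m\<in>{N<..M}. y * (1 / (real m)\<^sup>2))"
  proof (rule sum_mono)
    fix m
    show "real (card (?K (y / (real m)\<^sup>2))) \<le> y * (1 / (real m)\<^sup>2)"
      using card_prime_or_semiprime_trivial[of "y / (real m)\<^sup>2"] y by simp
  qed
  also have "\<dots> = y * (\<Sum>m\<in>{N<..M}. 1 / (real m)\<^sup>2)" by (simp only: sum_distrib_left)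
  finally have le: "real (card ?S) \<le> 2 * W * y / ln y * (\<Sum>m\<in>{1..N}. 1 / (real m)\<^sup>2)
      + y * (\<Sum>m\<in>{N<..M}. 1 / (real m)\<^sup>2)"
    by simp
  have "(\<Sum>m\<in>{1..N}. 1 / (real m)\<^sup>2) \<le> 2"
  proof -
    have "{1..N} = insert 1 {1<..N}" using N(3) by auto
    then have "(\<Sum>m\<in>{1..N}. 1 / (real m)\<^sup>2) = 1 + (\<Sum>m\<in>{1<..N}. 1 / (real m)\<^sup>2)" by simp
    moreover have "(\<Sum>m\<in>{1<..N}. 1 / (real m)\<^sup>2) \<le> 1 - 1 / real N"
      using N(3) sum_inverse_squares_tail[of 1 N] by simp
    moreover have "0 \<le> 1 / real N" by simp
    ultimately show ?thesis by linarith
  qed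
  moreover have "0 \<le> W" using ly by (simp add: W_def)
  ultimately have main: "2 * W * y / ln y * (\<Sum>m\<in>{1..N}. 1 / (real m)\<^sup>2) \<le> 2 * W * y / ln y * 2"
    using ly y by (intro mult_left_mono) auto
  have "(\<Sum>m\<in>{N<..M}. 1 / (real m)\<^sup>2) \<le> 1 / real N - 1 / real M"
    using N(3) \<open>N \<le> M\<close> by (rule sum_inverse_squares_tail)
  moreover have "0 \<le> 1 / real M" by simp
  \<comment> \<open>Rounding the fourth root down to \<open>N\<close> loses at most a factor
    2.\<close>
  moreover have "1 / real N \<le> 1 / (sqrt (sqrt y) / 2)" using N r2 y by (intro frac_le) auto
  ultimately have "(\<Sum>m\<in>{N<..M}. 1 / (real m)\<^sup>2) \<le> 1 / (sqrt (sqrt y) / 2)" by linarith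
  then have "y * (\<Sum>m\<in>{N<..M}. 1 / (real m)\<^sup>2) \<le> y * (1 / (sqrt (sqrt y) / 2))"
    using y by (intro mult_left_mono) auto
  with main have "2 * W * y / ln y * (\<Sum>m\<in>{1..N}. 1 / (real m)\<^sup>2)
      + y * (\<Sum>m\<in>{N<..M}. 1 / (real m)\<^sup>2) \<le> 2 * W * y / ln y * 2 + y * (1 / (sqrt (sqrt y) / 2))"
    by (rule add_mono)
  also have "\<dots> = 4 * W * y / ln y + 2 * y / sqrt (sqrt y)" by (simp add: mult_ac)
  finally show ?thesis using le by (simp add: W_def)
qed

theorem theorem2p4:
  shows "(\<lambda>y::real. real (card {n \<in> B. real n \<le> y \<and> [n = 3] (mod 8)}))
           \<in> O[at_top](\<lambda>y. y * ln (ln y) / ln y)"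
proof -
  let ?h = "\<lambda>y :: real. 4 * (228 + 48 * ln (ln y)) * y / ln y + 2 * y / sqrt (sqrt y)"
  have "(\<lambda>y::real. real (card {n \<in> B. real n \<le> y \<and> [n = 3] (mod 8)})) \<in> O[at_top](?h)"
  proof (rule bigoI[where c = 1])
    show "\<forall>\<^sub>F y in at_top. norm (real (card {n \<in> B. real n \<le> y \<and> [n = 3] (mod 8)})) \<le> 1 * norm (?h y)"
      using eventually_ge_at_top[of "16 :: real"]
    proof eventually_elim
      fix y :: real assume y: "16 \<le> y"
      let ?S = "{n. (\<exists>s m. prime_or_semiprime s \<and> n = s * m\<^sup>2 \<and> 0 < m) \<and> real n \<le> y}"
      have "{n \<in> B. real n \<le> y \<and> [n = 3] (mod 8)} \<subseteq> ?S"
      proof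
        fix n assume n: "n \<in> {n \<in> B. real n \<le> y \<and> [n = 3] (mod 8)}"
        then obtain s m where sm: "prime_or_semiprime s" "n = s * m\<^sup>2" using B_cong_3_obtain by blast
        have "n \<noteq> 0" using n by (auto simp: Cong.cong_def)
        then have "0 < m" using sm(2) by auto
        then show "n \<in> ?S" using sm n by blast
      qed
      then have "card {n \<in> B. real n \<le> y \<and> [n = 3] (mod 8)} \<le> card ?S"
        by (rule card_mono[rotated]) simp
      then have "real (card {n \<in> B. real n \<le> y \<and> [n = 3] (mod 8)}) \<le> real (card ?S)" by simp
      also have "\<dots> \<le> ?h y" using y by (rule card_prime_or_semiprime_times_square)
      finally show "norm (real (card {n \<in> B. real n \<le> y \<and> [n = 3] (mod 8)})) \<le> 1 * norm (?h y)"
        by simp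
    qed
  qed
  \<comment> \<open>The second term of \<open>?h\<close> has order \<open>y^(3/4)\<close> and is
    absorbed.\<close>
  also have "?h \<in> O[at_top](\<lambda>y. y * ln (ln y) / ln y)" by real_asymp
  finally show ?thesis .
qed

end
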